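(* Let $R$ be a Prüfer domain, and let $\mathcal U$ be a set of finitely presented cyclic $R$-modules. Let further $\mathcal L$ be the Gabriel topology having as basis the set $\mathcal B$ of all non-zero finitely generated ideals $I$ such that $R/I\in\mathcal U$. Then the universal localization $\lambda_{\mathcal U}:R\to R_{\mathcal U}$ at $\mathcal U$ is equivalent to $\lambda_{\mathcal L}:R\to Q_{\mathcal L}$, i.e. there is a ring isomorphism $\varphi:R_{\mathcal U}\to Q_{\mathcal L}$ with $\lambda_{\mathcal L}=\varphi\lambda_{\mathcal U}$.
   Context: A Prüfer domain is a commutative domain in which every finitely generated ideal is projective; over it all finitely presented modules have projective dimension at most one. A Gabriel topology on $R$ is a non-empty set $\mathcal G$ of ideals such that: (a) $I\in\mathcal G$, $I\subseteq K$ imply $K\in\mathcal G$; (b) $I,K\in\mathcal G$ imply $I\cap K\in\mathcal G$; (c) $I\in\mathcal G$, $x\in R$ imply $(I:x)=\{r\in R\mid xr\in I\}\in\mathcal G$; (d) if $K$ is an ideal and there is $I\in\mathcal G$ with $(K:x)\in\mathcal G$ for all $x\in I$, then $K\in\mathcal G$. A basis of $\mathcal G$ is a subset of $\mathcal G$ such that every ideal in $\mathcal G$ contains an ideal from this subset. A module $C$ is $\mathcal G$-closed if $\operatorname{Hom}_R(R,C)\to\operatorname{Hom}_R(I,C)$ is bijective for all $I\in\mathcal G$. The inclusion of the category of $\mathcal G$-closed modules into $\operatorname{Mod}R$ has an exact left adjoint; $Q_{\mathcal G}$ is the image of $R$ under it, and the unit $\lambda_{\mathcal G}:R\to Q_{\mathcal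 G}$ induces a ring structure on $Q_{\mathcal G}$ for which $\lambda_{\mathcal G}$ is a ring homomorphism. For a set $\mathcal U$ of finitely presented modules of projective dimension at most one, choose exact sequences $0\to P\xrightarrow{\alpha_U}Q\to U\to0$ ($U\in\mathcal U$) with $P,Q$ finitely generated projective. The universal localization $\lambda_{\mathcal U}:R\to R_{\mathcal U}$ is the ring homomorphism such that all $\alpha_U\otimes_RR_{\mathcal U}$ are isomorphisms and which is universal among ring homomorphisms out of $R$ with this property; it does not depend on the chosen $\alpha_U$.
   Formalization: Adds the assumption that no module in U is isomorphic to R itself: if R ∈ U then the universal localization is 0, while Q_L contains the domain R, so the claim fails (e.g. U = {R, 0}, where B = {R} and Q_L = R). *)

theory Defs
  imports "HOL-Algebra.Algebra" "HOL-Algebra.Free_Abelian_Groups"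
begin

section \<open>Modules over a commutative ring\<close>

text \<open>
  A module is a record of type \<^typ>\<open>('a, 'b) module\<close>; its ring fields \<open>mult\<close> and \<open>one\<close> are
  ignored by the library locale \<^locale>\<open>module\<close> and carry no meaning.  Homomorphisms are
  taken extensional, so that equality of homomorphisms is equality of HOL functions.
\<close>

definition module_homs ::
  "('a, 'm) ring_scheme \<Rightarrow> ('a, 'b) module \<Rightarrow> ('a, 'c) module \<Rightarrow> ('b \<Rightarrow> 'c) set" where
  "module_homs R M N = {f \<in> extensional (carrier M).
     f \<in> carrier M \<rightarrow> carrier N \<and>
     (\<forall>x\<in>carrier M. \<forall>y\<in>carrier M. f (x \<oplus>\<^bsub>M\<^esub> y) = f x \<oplus>\<^bsub>N\<^esub> f y) \<and>
     (\<forall>r\<in>carrier R. \<forall>x\<in>carrier M. f (r \<odot>\<^bsub>M\<^esub> x) = r \<odot>\<^bsub>N\<^esub> f x)}"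

definition module_isomorphic ::
  "('a, 'm) ring_scheme \<Rightarrow> ('a, 'b) module \<Rightarrow> ('a, 'c) module \<Rightarrow> bool" where
  "module_isomorphic R M N \<longleftrightarrow>
     (\<exists>f\<in>module_homs R M N. bij_betw f (carrier M) (carrier N))"

definition ideal_module :: "('a, 'm) ring_scheme \<Rightarrow> 'a set \<Rightarrow> ('a, 'a) module" where
  "ideal_module R I = \<lparr>carrier = I, monoid.mult = monoid.mult R, one = \<one>\<^bsub>R\<^esub>,
     ring.zero = \<zero>\<^bsub>R\<^esub>, add = add R, smult = monoid.mult R\<rparr>"

abbreviation regular_module :: "('a, 'm) ring_scheme \<Rightarrow> ('a, 'a) module" where
  "regular_module R \<equiv> ideal_module R (carrier R)"

text \<open>
  A ring \<open>S\<close> as a module over \<open>R\<close> along a ring homomorphism \<open>h\<close> from \<open>R\<close> to \<open>S\<close>.  If \<open>S\<close> is not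
  commutative, this is the left module structure.
\<close>

definition restrict_scalars :: "('s, 'n) ring_scheme \<Rightarrow> ('a \<Rightarrow> 's) \<Rightarrow> ('a, 's) module" where
  "restrict_scalars S h = \<lparr>carrier = carrier S, monoid.mult = monoid.mult S, one = \<one>\<^bsub>S\<^esub>,
     ring.zero = \<zero>\<^bsub>S\<^esub>, add = add S, smult = (\<lambda>r s. h r \<otimes>\<^bsub>S\<^esub> s)\<rparr>"

definition quotient_module :: "('a, 'm) ring_scheme \<Rightarrow> 'a set \<Rightarrow> ('a, 'a set) module" where
  "quotient_module R I = restrict_scalars (R Quot I) (\<lambda>r. I +>\<^bsub>R\<^esub> r)"

definition module_span ::
  "('a, 'm) ring_scheme \<Rightarrow> ('a, 'b) module \<Rightarrow> 'b set \<Rightarrow> 'b set" where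
  "module_span R M A = \<Inter>{N. submodule N R M \<and> A \<subseteq> N}"

definition finitely_generated_module ::
  "('a, 'm) ring_scheme \<Rightarrow> ('a, 'b) module \<Rightarrow> bool" where
  "finitely_generated_module R M \<longleftrightarrow> module R M \<and>
     (\<exists>A. finite A \<and> A \<subseteq> carrier M \<and> module_span R M A = carrier M)"

definition cyclic_module :: "('a, 'm) ring_scheme \<Rightarrow> ('a, 'b) module \<Rightarrow> bool" where
  "cyclic_module R M \<longleftrightarrow> module R M \<and>
     (\<exists>x\<in>carrier M. module_span R M {x} = carrier M)"

definition free_module :: "('a, 'm) ring_scheme \<Rightarrow> 'x set \<Rightarrow> ('a, 'x \<Rightarrow> 'a) module" where
  "free_module R B = \<lparr>carrier = {f. (\<forall>x\<in>B. f x \<in> carrier R) \<and> (\<forall>x. x \<notin> B \<longrightarrow> f x = \<zero>\<^bsub>R\<^esub>) \<and>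
       finite {x. f x \<noteq> \<zero>\<^bsub>R\<^esub>}},
     monoid.mult = undefined, one = undefined, ring.zero = (\<lambda>x. \<zero>\<^bsub>R\<^esub>),
     add = (\<lambda>f g x. f x \<oplus>\<^bsub>R\<^esub> g x),
     smult = (\<lambda>r f x. r \<otimes>\<^bsub>R\<^esub> f x)\<rparr>"

definition finitely_presented_module ::
  "('a, 'm) ring_scheme \<Rightarrow> ('a, 'b) module \<Rightarrow> bool" where
  "finitely_presented_module R M \<longleftrightarrow> module R M \<and>
     (\<exists>(n::nat) p A. p \<in> module_homs R (free_module R {..<n}) M \<and>
        p ` carrier (free_module R {..<n}) = carrier M \<and>
        finite A \<and> A \<subseteq> carrier (free_module R {..<n}) \<and>
        a_kernel (free_module R {..<n}) M p = module_span R (free_module R {..<n}) A)"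

text \<open>
  Projective means direct summand (retract) of a free module.  Restricting the basis \<open>B\<close> to
  the type of the elements of \<open>M\<close> loses nothing: a projective \<open>M\<close> is a retract of the
  free module on the set \<open>carrier M\<close>.
\<close>

definition projective_module ::
  "('a, 'm) ring_scheme \<Rightarrow> ('a, 'b) module \<Rightarrow> bool" where
  "projective_module R M \<longleftrightarrow> module R M \<and>
     (\<exists>(B::'b set) i p. i \<in> module_homs R M (free_module R B) \<and>
        p \<in> module_homs R (free_module R B) M \<and> (\<forall>x\<in>carrier M. p (i x) = x))"

definition finitely_generated_ideal :: "('a, 'm) ring_scheme \<Rightarrow> 'a set \<Rightarrow> bool" where
  "finitely_generated_ideal R I \<longleftrightarrow> ideal I R \<and>
     (\<exists>A. finite A \<and> A \<subseteq> carrier R \<and> I = Idl\<^bsub>R\<^esub> A)"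

definition pruefer_domain :: "('a, 'm) ring_scheme \<Rightarrow> bool" where
  "pruefer_domain R \<longleftrightarrow> domain R \<and>
     (\<forall>I. finitely_generated_ideal R I \<longrightarrow> projective_module R (ideal_module R I))"


section \<open>Gabriel topologies\<close>

definition ideal_colon :: "('a, 'm) ring_scheme \<Rightarrow> 'a set \<Rightarrow> 'a \<Rightarrow> 'a set" where
  "ideal_colon R I x = {r \<in> carrier R. x \<otimes>\<^bsub>R\<^esub> r \<in> I}"

definition gabriel_topology :: "('a, 'm) ring_scheme \<Rightarrow> 'a set set \<Rightarrow> bool" where
  "gabriel_topology R G \<longleftrightarrow> G \<noteq> {} \<and> (\<forall>I\<in>G. ideal I R) \<and>
     (\<forall>I K. I \<in> G \<and> ideal K R \<and> I \<subseteq> K \<longrightarrow> K \<in> G) \<and>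
     (\<forall>I\<in>G. \<forall>K\<in>G. I \<inter> K \<in> G) \<and>
     (\<forall>I\<in>G. \<forall>x\<in>carrier R. ideal_colon R I x \<in> G) \<and>
     (\<forall>K. ideal K R \<and> (\<exists>I\<in>G. \<forall>x\<in>I. ideal_colon R K x \<in> G) \<longrightarrow> K \<in> G)"

definition basis_of_topology :: "'a set set \<Rightarrow> 'a set set \<Rightarrow> bool" where
  "basis_of_topology B G \<longleftrightarrow> B \<subseteq> G \<and> (\<forall>I\<in>G. \<exists>J\<in>B. J \<subseteq> I)"

definition closed_module ::
  "('a, 'm) ring_scheme \<Rightarrow> 'a set set \<Rightarrow> ('a, 'b) module \<Rightarrow> bool" where
  "closed_module R G C \<longleftrightarrow> module R C \<and>
     (\<forall>I\<in>G. bij_betw (\<lambda>f. restrict f I)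
        (module_homs R (regular_module R) C) (module_homs R (ideal_module R I) C))"

text \<open>
  \<open>gabriel_localization TYPE('t) R G Q l\<close>: the ring homomorphism \<open>l\<close> from \<open>R\<close> to \<open>Q\<close> is the value
  at \<open>R\<close> of the unit of the left adjoint to the inclusion of the closed modules into all
  modules, i.e. a universal arrow from \<open>R\<close> to that inclusion.  The ring structure on \<open>Q\<close> for which
  \<open>l\<close> is a ring homomorphism inducing the given module structure is unique.  A HOL formula cannot
  quantify over types, so the universal property is stated for the closed modules whose
  elements have a given type \<open>'t\<close>.
\<close>

definition gabriel_localization ::
  "'t itself \<Rightarrow> ('a, 'm) ring_scheme \<Rightarrow> 'a set set \<Rightarrow> ('q, 'n) ring_scheme \<Rightarrow> ('a \<Rightarrow> 'q) \<Rightarrow> bool" where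
  "gabriel_localization _ R G Q l \<longleftrightarrow>
     ring Q \<and> l \<in> ring_hom R Q \<and> closed_module R G (restrict_scalars Q l) \<and>
     (\<forall>C::('a, 't) module. closed_module R G C \<longrightarrow>
        (\<forall>f\<in>module_homs R (regular_module R) C.
           \<exists>!g. g \<in> module_homs R (restrict_scalars Q l) C \<and> (\<forall>r\<in>carrier R. g (l r) = f r)))"


section \<open>Tensor products\<close>

text \<open>
  The tensor product of two modules is the free abelian group on pairs modulo
  biadditivity and balancedness; it is written multiplicatively, as are all groups in the library.
\<close>

definition tensor_relations ::
  "('a, 'm) ring_scheme \<Rightarrow> ('a, 'b) module \<Rightarrow> ('a, 'c) module \<Rightarrow> (('b \<times> 'c) \<Rightarrow>\<^sub>0 int) set" where
  "tensor_relations R M N =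
     {frag_of (x \<oplus>\<^bsub>M\<^esub> x', y) - frag_of (x, y) - frag_of (x', y) | x x' y.
        x \<in> carrier M \<and> x' \<in> carrier M \<and> y \<in> carrier N} \<union>
     {frag_of (x, y \<oplus>\<^bsub>N\<^esub> y') - frag_of (x, y) - frag_of (x, y') | x y y'.
        x \<in> carrier M \<and> y \<in> carrier N \<and> y' \<in> carrier N} \<union>
     {frag_of (r \<odot>\<^bsub>M\<^esub> x, y) - frag_of (x, r \<odot>\<^bsub>N\<^esub> y) | r x y.
        r \<in> carrier R \<and> x \<in> carrier M \<and> y \<in> carrier N}"

definition tensor_kernel ::
  "('a, 'm) ring_scheme \<Rightarrow> ('a, 'b) module \<Rightarrow> ('a, 'c) module \<Rightarrow> (('b \<times> 'c) \<Rightarrow>\<^sub>0 int) set" where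
  "tensor_kernel R M N =
     generate (free_Abelian_group (carrier M \<times> carrier N)) (tensor_relations R M N)"

definition tensor_product ::
  "('a, 'm) ring_scheme \<Rightarrow> ('a, 'b) module \<Rightarrow> ('a, 'c) module \<Rightarrow> (('b \<times> 'c) \<Rightarrow>\<^sub>0 int) set monoid" where
  "tensor_product R M N =
     free_Abelian_group (carrier M \<times> carrier N) Mod tensor_kernel R M N"

text \<open>The map \<open>a \<otimes> N\<close> induced by \<open>a\<close> from \<open>M\<close> to \<open>M'\<close>: it sends the class of \<open>(x, y)\<close> to the class
  of \<open>(a x, y)\<close>.\<close>

definition tensor_map ::
  "('a, 'm) ring_scheme \<Rightarrow> ('b \<Rightarrow> 'd) \<Rightarrow> ('a, 'd) module \<Rightarrow> ('a, 'c) module \<Rightarrow>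
   (('b \<times> 'c) \<Rightarrow>\<^sub>0 int) set \<Rightarrow> (('d \<times> 'c) \<Rightarrow>\<^sub>0 int) set" where
  "tensor_map R a M' N B = the_elem
     ((\<lambda>c. tensor_kernel R M' N #>\<^bsub>free_Abelian_group (carrier M' \<times> carrier N)\<^esub>
           frag_extend (\<lambda>(x, y). frag_of (a x, y)) c) ` B)"


section \<open>Universal localization\<close>

definition fg_projective_presentation ::
  "('a, 'm) ring_scheme \<Rightarrow> ('a, 'c) module \<Rightarrow> ('a, 'd) module \<Rightarrow> ('a, 'b) module \<Rightarrow>
   ('c \<Rightarrow> 'd) \<Rightarrow> ('d \<Rightarrow> 'b) \<Rightarrow> bool" where
  "fg_projective_presentation R P Q M a p \<longleftrightarrow>
     finitely_generated_module R P \<and> projective_module R P \<and>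
     finitely_generated_module R Q \<and> projective_module R Q \<and>
     a \<in> module_homs R P Q \<and> p \<in> module_homs R Q M \<and>
     inj_on a (carrier P) \<and> a ` carrier P = a_kernel Q M p \<and> p ` carrier Q = carrier M"

text \<open>
  The induced map \<open>P M \<otimes> S \<rightarrow> Q M \<otimes> S\<close> is always a homomorphism of right modules over \<open>S\<close>, hence it is
  an isomorphism of such modules iff it is an isomorphism of the underlying groups.
\<close>

definition inverts ::
  "('a, 'm) ring_scheme \<Rightarrow> ('a, 'b) module set \<Rightarrow>
   (('a, 'b) module \<Rightarrow> ('a, 'c) module) \<Rightarrow> (('a, 'b) module \<Rightarrow> ('a, 'd) module) \<Rightarrow>
   (('a, 'b) module \<Rightarrow> 'c \<Rightarrow> 'd) \<Rightarrow> ('s, 'n) ring_scheme \<Rightarrow> ('a \<Rightarrow> 's) \<Rightarrow> bool" where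
  "inverts R \<U> P Q \<alpha> S l \<longleftrightarrow>
     (\<forall>M\<in>\<U>. tensor_map R (\<alpha> M) (Q M) (restrict_scalars S l)
        \<in> iso (tensor_product R (P M) (restrict_scalars S l))
              (tensor_product R (Q M) (restrict_scalars S l)))"

text \<open>
  \<open>universal_localization TYPE('t) R \<U> P Q \<alpha> S l\<close>: the ring homomorphism \<open>l\<close> from \<open>R\<close> to \<open>S\<close> makes
  the maps \<open>\<alpha> M \<otimes> S\<close> bijective and is universal with this property among the homomorphisms to
  (not necessarily commutative) rings whose elements have type \<open>'t\<close>.  As a hypothesis, the
  universal property at finitely many types \<open>'t\<close> is weaker than the universal property at all
  types.  The factorization \<open>h\<close> is made extensional so that uniqueness means uniqueness on
  \<open>carrier S\<close>.
\<close>

definition universal_localization ::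
  "'t itself \<Rightarrow> ('a, 'm) ring_scheme \<Rightarrow> ('a, 'b) module set \<Rightarrow>
   (('a, 'b) module \<Rightarrow> ('a, 'c) module) \<Rightarrow> (('a, 'b) module \<Rightarrow> ('a, 'd) module) \<Rightarrow>
   (('a, 'b) module \<Rightarrow> 'c \<Rightarrow> 'd) \<Rightarrow> ('s, 'n) ring_scheme \<Rightarrow> ('a \<Rightarrow> 's) \<Rightarrow> bool" where
  "universal_localization _ R \<U> P Q \<alpha> S l \<longleftrightarrow>
     ring S \<and> l \<in> ring_hom R S \<and> inverts R \<U> P Q \<alpha> S l \<and>
     (\<forall>(T::'t ring) m. ring T \<and> m \<in> ring_hom R T \<and> inverts R \<U> P Q \<alpha> T m \<longrightarrow>
        (\<exists>!h. h \<in> extensional (carrier S) \<and> h \<in> ring_hom S T \<and> (\<forall>r\<in>carrier R. h (l r) = m r)))"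

text \<open>A set of modules is only used up to isomorphism: \<open>R/I \<in> \<U>\<close> is read as \<open>R/I\<close> being isomorphic
  to a member of \<open>\<U>\<close>.\<close>

definition ideal_basis ::
  "('a, 'm) ring_scheme \<Rightarrow> ('a, 'b) module set \<Rightarrow> 'a set set" where
  "ideal_basis R \<U> = {I. finitely_generated_ideal R I \<and> I \<noteq> {\<zero>\<^bsub>R\<^esub>} \<and>
     (\<exists>M\<in>\<U>. module_isomorphic R (quotient_module R I) M)}"

end

theory Submission
  imports Defs
begin

text \<open>
  Let \<open>M \<cong> R/I\<close> be in \<open>\<U>\<close>.  As \<open>M\<close> is not free, \<open>I\<close> is nonzero, hence invertible.  A ring
  homomorphism \<open>l\<close> from \<open>R\<close> to \<open>S\<close> that inverts the presentation of \<open>M\<close> satisfies \<open>1 \<in> l(I)S\<close>, and only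
  \<open>0\<close> is annihilated by \<open>l(I)\<close>; by invertibility of \<open>I\<close> every homomorphism from \<open>I\<close> to \<open>S\<close> is then given
  by a unique element of \<open>S\<close>, so that the universal localization is closed.  Conversely, \<open>l(R)\<close> is central in the
  Gabriel localization, and the elements that represent the functionals of a dual basis of \<open>I\<close>
  provide an inverse of the presentation map tensored with the Gabriel localization.  The two universal properties give
  maps in both directions.  The one from the Gabriel localization is a priori only linear; it is
  multiplicative because \<open>s \<mapsto> g (s t)\<close> and \<open>s \<mapsto> g s g t\<close> agree on the image of \<open>R\<close>.
\<close>

section \<open>Tensor products\<close>

text \<open>The given presentation 0 -> P -> Q -> M -> 0 is arbitrary, not 0 -> I -> R -> R/I -> 0.
  The two are compared as in Schanuel's lemma: a lift of the generator of M to Q yields a split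
  exact sequence 0 -> I -> R + P -> Q -> 0, and everything that is done with I is carried to P and Q
  along its maps.

  A ring that inverts the presentations need not be commutative, and the image of R is not known to
  be central in it. Scalars therefore act on the left throughout, and a functional on I is extended
  to S by showing that a suitable additive subgroup of S contains 1, not by dividing.

  Invertibility of I enters only through functionals \<open>c b\<close> and elements
  \<open>e b\<close> of I with \<open>c b (e b)\<close> summing to 1. The \<open>c b\<close> are
  multiplications by elements of the inverse ideal, but no fraction field is formed.

  The module R itself has to be kept out of the set: with the presentation 0 -> 0 -> R -> R -> 0 it
  would force the universal localization to be the zero ring, whereas its annihilator, the zero
  ideal, never belongs to the basis.\<close>

definition pure_tensor ::
  "('a, 'm) ring_scheme \<Rightarrow> ('a, 'b) module \<Rightarrow> ('a, 'c) module \<Rightarrow> 'b \<Rightarrow> 'c \<Rightarrow> (('b \<times> 'c) \<Rightarrow>\<^sub>0 int) set" where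
  "pure_tensor R M N x y =
     tensor_kernel R M N #>\<^bsub>free_Abelian_group (carrier M \<times> carrier N)\<^esub> frag_of (x, y)"

locale module_pair = M: module R M + N: module R N
  for R :: "('a, 'm) ring_scheme" and M :: "('a, 'b) module" and N :: "('a, 'c) module"
begin

abbreviation "F \<equiv> free_Abelian_group (carrier M \<times> carrier N)"
abbreviation "K \<equiv> tensor_kernel R M N"
abbreviation "T \<equiv> tensor_product R M N"
abbreviation "pure \<equiv> pure_tensor R M N"

lemma tensor_relations_carrier: "tensor_relations R M N \<subseteq> carrier F"
proof -
  have k: "Poly_Mapping.keys (u - v) \<subseteq> A" if "Poly_Mapping.keys u \<subseteq> A" "Poly_Mapping.keys v \<subseteq> A"
    for u v :: "('b \<times> 'c) \<Rightarrow>\<^sub>0 int" and A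
    using keys_diff[of u v] that by blast
  show ?thesis
    unfolding tensor_relations_def by (auto intro!: k dest!: subsetD[OF keys_diff])
qed

sublocale F: comm_group F by (rule abelian_free_Abelian_group)

lemma subgroup_tensor_kernel: "subgroup K F"
  unfolding tensor_kernel_def by (rule F.generate_is_subgroup[OF tensor_relations_carrier])

lemma normal_tensor_kernel: "K \<lhd> F"
  using subgroup_tensor_kernel F.normal_iff_subgroup by blast

sublocale T: comm_group T
  unfolding tensor_product_def by (rule F.abelian_FactGroup[OF subgroup_tensor_kernel])

lemma coset_hom: "(\<lambda>c. K #>\<^bsub>F\<^esub> c) \<in> hom F T"
  unfolding tensor_product_def by (rule normal.r_coset_hom_Mod[OF normal_tensor_kernel])

lemma pure_closed [simp, intro]: "x \<in> carrier M \<Longrightarrow> y \<in> carrier N \<Longrightarrow> pure x y \<in> carrier T"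
  unfolding pure_tensor_def using hom_in_carrier[OF coset_hom, of "frag_of (x, y)"] by simp

text \<open>The two additivity relations have the shape u - v - w, and the balancing relation has it
  with w = 0, so one lemma turns all three families into equations between cosets.\<close>

lemma coset_relation:
  assumes "u - v - w \<in> tensor_relations R M N" "v \<in> carrier F" "w \<in> carrier F"
  shows "K #>\<^bsub>F\<^esub> u = (K #>\<^bsub>F\<^esub> v) \<otimes>\<^bsub>T\<^esub> (K #>\<^bsub>F\<^esub> w)"
proof -
  have k: "u - v - w \<in> K" unfolding tensor_kernel_def using assms(1) by (rule generate.incl)
  then have kc: "u - v - w \<in> carrier F" using subgroup.mem_carrier[OF subgroup_tensor_kernel] by blast
  have vw: "v \<otimes>\<^bsub>F\<^esub> w \<in> carrier F" using assms by blast
  have "u = (u - v - w) \<otimes>\<^bsub>F\<^esub> (v \<otimes>\<^bsub>F\<^esub> w)" by simp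
  then have "u \<in> K #>\<^bsub>F\<^esub> (v \<otimes>\<^bsub>F\<^esub> w)" unfolding r_coset_def using k by blast
  then have "K #>\<^bsub>F\<^esub> (v \<otimes>\<^bsub>F\<^esub> w) = K #>\<^bsub>F\<^esub> u"
    by (rule F.repr_independence[OF _ vw subgroup_tensor_kernel])
  then show ?thesis using hom_mult[OF coset_hom assms(2,3)] by simp
qed

lemma pure_add_left:
  assumes "x \<in> carrier M" "x' \<in> carrier M" "y \<in> carrier N"
  shows "pure (x \<oplus>\<^bsub>M\<^esub> x') y = pure x y \<otimes>\<^bsub>T\<^esub> pure x' y"
  unfolding pure_tensor_def
  by (rule coset_relation) (use assms in \<open>auto simp: tensor_relations_def\<close>)

lemma pure_add_right:
  assumes "x \<in> carrier M" "y \<in> carrier N" "y' \<in> carrier N"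
  shows "pure x (y \<oplus>\<^bsub>N\<^esub> y') = pure x y \<otimes>\<^bsub>T\<^esub> pure x y'"
  unfolding pure_tensor_def
  by (rule coset_relation) (use assms in \<open>auto simp: tensor_relations_def\<close>)

lemma pure_balanced:
  assumes "r \<in> carrier R" "x \<in> carrier M" "y \<in> carrier N"
  shows "pure (r \<odot>\<^bsub>M\<^esub> x) y = pure x (r \<odot>\<^bsub>N\<^esub> y)"
proof -
  have "frag_of (r \<odot>\<^bsub>M\<^esub> x, y) - frag_of (x, r \<odot>\<^bsub>N\<^esub> y) - 0 \<in> tensor_relations R M N"
    using assms by (auto simp: tensor_relations_def)
  from coset_relation[OF this] have "pure (r \<odot>\<^bsub>M\<^esub> x) y = pure x (r \<odot>\<^bsub>N\<^esub> y) \<otimes>\<^bsub>T\<^esub> (K #>\<^bsub>F\<^esub> 0)"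
    unfolding pure_tensor_def using assms by simp
  moreover have "K #>\<^bsub>F\<^esub> 0 = \<one>\<^bsub>T\<^esub>"
    using hom_one[OF coset_hom F.is_group T.is_group] by simp
  ultimately show ?thesis using assms by simp
qed

lemma pure_zero_left: "y \<in> carrier N \<Longrightarrow> pure \<zero>\<^bsub>M\<^esub> y = \<one>\<^bsub>T\<^esub>"
  using pure_add_left[of "\<zero>\<^bsub>M\<^esub>" "\<zero>\<^bsub>M\<^esub>" y] T.l_cancel_one' by simp

lemma pure_zero_right: "x \<in> carrier M \<Longrightarrow> pure x \<zero>\<^bsub>N\<^esub> = \<one>\<^bsub>T\<^esub>"
  using pure_add_right[of x "\<zero>\<^bsub>N\<^esub>" "\<zero>\<^bsub>N\<^esub>"] T.l_cancel_one' by simp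

lemma pure_finsum_left:
  assumes "finite A" "f \<in> A \<rightarrow> carrier M" "y \<in> carrier N"
  shows "pure (finsum M f A) y = finprod T (\<lambda>i. pure (f i) y) A"
  using assms
proof (induction A)
  case (insert i A)
  then show ?case
    by (subst M.finsum_insert T.finprod_insert; auto simp: pure_add_left Pi_iff)+
qed (simp add: pure_zero_left)

lemma pure_finsum_right:
  assumes "finite A" "f \<in> A \<rightarrow> carrier N" "x \<in> carrier M"
  shows "pure x (finsum N f A) = finprod T (\<lambda>i. pure x (f i)) A"
  using assms
proof (induction A)
  case (insert i A)
  then show ?case
    by (subst N.finsum_insert T.finprod_insert; auto simp: pure_add_right Pi_iff)+
qed (simp add: pure_zero_right)

text \<open>Closure under quotients suffices because the neutral element is itself a pure tensor,
  that of two zeros.\<close>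

lemma tensor_induct [consumes 1, case_names pure div]:
  assumes t: "t \<in> carrier T"
    and pure: "\<And>x y. x \<in> carrier M \<Longrightarrow> y \<in> carrier N \<Longrightarrow> Pr (pure x y)"
    and div: "\<And>s t. s \<in> carrier T \<Longrightarrow> t \<in> carrier T \<Longrightarrow> Pr s \<Longrightarrow> Pr t \<Longrightarrow> Pr (s \<otimes>\<^bsub>T\<^esub> inv\<^bsub>T\<^esub> t)"
  shows "Pr t"
proof -
  have coset_diff: "K #>\<^bsub>F\<^esub> (u - v) = (K #>\<^bsub>F\<^esub> u) \<otimes>\<^bsub>T\<^esub> inv\<^bsub>T\<^esub> (K #>\<^bsub>F\<^esub> v)"
    if "u \<in> carrier F" "v \<in> carrier F" for u v
  proof -
    interpret group_hom F T "\<lambda>c. K #>\<^bsub>F\<^esub> c" by unfold_locales (rule coset_hom)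
    have "u - v = u \<otimes>\<^bsub>F\<^esub> inv\<^bsub>F\<^esub> v" using that by simp
    then show ?thesis using that hom_mult F.inv_closed hom_inv by metis
  qed
  obtain c where c: "Poly_Mapping.keys c \<subseteq> carrier M \<times> carrier N" "t = K #>\<^bsub>F\<^esub> c"
    using t unfolding tensor_product_def carrier_FactGroup by auto
  from c(1) have "Pr (K #>\<^bsub>F\<^esub> c)"
  proof (induction rule: free_Abelian_group_induct [consumes 1, case_names zero diff of])
    case zero
    show ?case
    proof -
      have "pure \<zero>\<^bsub>M\<^esub> \<zero>\<^bsub>N\<^esub> = K #>\<^bsub>F\<^esub> 0"
        using pure_zero_left[of "\<zero>\<^bsub>N\<^esub>"] hom_one[OF coset_hom F.is_group T.is_group] by simp
      then show ?thesis using pure[of "\<zero>\<^bsub>M\<^esub>" "\<zero>\<^bsub>N\<^esub>"] by simp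
    qed
  next
    case (diff x y)
    then show ?case
      using assms(3) coset_diff[of x y] hom_in_carrier[OF coset_hom] by simp
  next
    case (of a)
    then show ?case using pure by (cases a) (auto simp: pure_tensor_def)
  qed
  then show ?thesis using c by simp
qed

lemma tensor_hom_eq:
  assumes "group G" "f \<in> hom T G" "g \<in> hom T G"
    and "\<And>x y. x \<in> carrier M \<Longrightarrow> y \<in> carrier N \<Longrightarrow> f (pure x y) = g (pure x y)"
    and "t \<in> carrier T"
  shows "f t = g t"
  using assms(5)
proof (induction rule: tensor_induct)
  case (div s t)
  interpret f: group_hom T G f using assms T.is_group by (simp add: group_hom_def group_hom_axioms_def)
  interpret g: group_hom T G g using assms T.is_group by (simp add: group_hom_def group_hom_axioms_def)
  show ?case using div by (simp add: f.hom_mult g.hom_mult f.hom_inv g.hom_inv)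
qed (use assms in auto)

text \<open>The map extends freely to formal sums of pairs; biadditivity and balancedness say that
  the extension kills the relations, hence the subgroup they generate, so that it descends to the
  quotient.\<close>

lemma tensor_universal:
  assumes "comm_group G"
    and closed: "\<And>x y. x \<in> carrier M \<Longrightarrow> y \<in> carrier N \<Longrightarrow> f x y \<in> carrier G"
    and l: "\<And>x x' y. x \<in> carrier M \<Longrightarrow> x' \<in> carrier M \<Longrightarrow> y \<in> carrier N \<Longrightarrow>
      f (x \<oplus>\<^bsub>M\<^esub> x') y = f x y \<otimes>\<^bsub>G\<^esub> f x' y"
    and r: "\<And>x y y'. x \<in> carrier M \<Longrightarrow> y \<in> carrier N \<Longrightarrow> y' \<in> carrier N \<Longrightarrow>
      f x (y \<oplus>\<^bsub>N\<^esub> y') = f x y \<otimes>\<^bsub>G\<^esub> f x y'"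
    and b: "\<And>r x y. r \<in> carrier R \<Longrightarrow> x \<in> carrier M \<Longrightarrow> y \<in> carrier N \<Longrightarrow>
      f (r \<odot>\<^bsub>M\<^esub> x) y = f x (r \<odot>\<^bsub>N\<^esub> y)"
  obtains h where "h \<in> hom T G" "\<And>x y. x \<in> carrier M \<Longrightarrow> y \<in> carrier N \<Longrightarrow> h (pure x y) = f x y"
proof -
  interpret G: comm_group G by fact
  obtain k where k: "k \<in> hom F G" "\<And>p. p \<in> carrier M \<times> carrier N \<Longrightarrow> k (frag_of p) = case_prod f p"
    by (rule G.free_Abelian_group_universal[of "case_prod f" "carrier M \<times> carrier N"])
       (use closed in auto)
  interpret k: group_hom F G k using k by unfold_locales
  have kdiff: "k (u - v) = k u \<otimes>\<^bsub>G\<^esub> inv\<^bsub>G\<^esub> k v" if "u \<in> carrier F" "v \<in> carrier F" for u v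
  proof -
    have "u - v = u \<otimes>\<^bsub>F\<^esub> inv\<^bsub>F\<^esub> v" using that by simp
    then show ?thesis using that k.hom_mult F.inv_closed k.hom_inv by metis
  qed
  have kof: "k (frag_of (x, y)) = f x y" if "x \<in> carrier M" "y \<in> carrier N" for x y
    using k(2)[of "(x, y)"] that by simp
  have dc: "u - v \<in> carrier F" if "u \<in> carrier F" "v \<in> carrier F" for u v
    using F.m_closed[OF that(1) F.inv_closed[OF that(2)]] that by simp
  \<comment> \<open>This is the value taken on both kinds of additivity relation once the sum in the
    first term is expanded.\<close>
  have cancel: "a \<otimes>\<^bsub>G\<^esub> c \<otimes>\<^bsub>G\<^esub> inv\<^bsub>G\<^esub> a \<otimes>\<^bsub>G\<^esub> inv\<^bsub>G\<^esub> c = \<one>\<^bsub>G\<^esub>"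
    if "a \<in> carrier G" "c \<in> carrier G" for a c
    using that by (metis G.inv_closed G.inv_solve_right' G.m_closed G.m_comm G.r_inv)
  have "k u = \<one>\<^bsub>G\<^esub>" if "u \<in> tensor_relations R M N" for u
    using that unfolding tensor_relations_def
  proof (elim UnE CollectE exE conjE)
    fix x x' y assume "u = frag_of (x \<oplus>\<^bsub>M\<^esub> x', y) - frag_of (x, y) - frag_of (x', y)"
      and *: "x \<in> carrier M" "x' \<in> carrier M" "y \<in> carrier N"
    then show ?thesis using closed by (simp add: kdiff dc kof l cancel del: carrier_free_Abelian_group_iff)
  next
    fix x y y' assume "u = frag_of (x, y \<oplus>\<^bsub>N\<^esub> y') - frag_of (x, y) - frag_of (x, y')"
      and *: "x \<in> carrier M" "y \<in> carrier N" "y' \<in> carrier N"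
    then show ?thesis using closed by (simp add: kdiff dc kof r cancel del: carrier_free_Abelian_group_iff)
  next
    fix s x y assume "u = frag_of (s \<odot>\<^bsub>M\<^esub> x, y) - frag_of (x, s \<odot>\<^bsub>N\<^esub> y)"
      and *: "s \<in> carrier R" "x \<in> carrier M" "y \<in> carrier N"
    then show ?thesis using closed by (simp add: kdiff dc kof b del: carrier_free_Abelian_group_iff)
  qed
  then have "tensor_relations R M N \<subseteq> kernel F G k"
    unfolding kernel_def using tensor_relations_carrier by blast
  then have "K \<subseteq> kernel F G k"
    unfolding tensor_kernel_def by (rule F.generate_subgroup_incl[OF _ k.subgroup_kernel])
  then obtain g where g: "g \<in> hom (F Mod K) G" "\<And>c. c \<in> carrier F \<Longrightarrow> g (K #>\<^bsub>F\<^esub> c) = k c"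
    using k.FactGroup_universal_kernel[OF normal_tensor_kernel] by metis
  show ?thesis
  proof
    show "g \<in> hom T G" using g(1) unfolding tensor_product_def .
    show "g (pure x y) = f x y" if "x \<in> carrier M" "y \<in> carrier N" for x y
      unfolding pure_tensor_def using that by (simp add: g(2) kof)
  qed
qed

end

section \<open>Functoriality of the tensor product\<close>

lemma module_homsD:
  assumes "f \<in> module_homs R M N"
  shows "f \<in> extensional (carrier M)"
    and "x \<in> carrier M \<Longrightarrow> f x \<in> carrier N"
    and "x \<in> carrier M \<Longrightarrow> y \<in> carrier M \<Longrightarrow> f (x \<oplus>\<^bsub>M\<^esub> y) = f x \<oplus>\<^bsub>N\<^esub> f y"
    and "r \<in> carrier R \<Longrightarrow> x \<in> carrier M \<Longrightarrow> f (r \<odot>\<^bsub>M\<^esub> x) = r \<odot>\<^bsub>N\<^esub> f x"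
  using assms unfolding module_homs_def by auto

text \<open>\<open>tensor_map\<close> is given as the only element of an image, which makes sense
  only if all representatives of a coset have the same image. That is seen by comparison with the
  homomorphism \<open>h\<close> supplied by the universal property, which agrees with the formula on
  every representative.\<close>

lemma tensor_map:
  assumes "module R M" "module R M'" "module R N" and a: "a \<in> module_homs R M M'"
  shows tensor_map_hom: "tensor_map R a M' N \<in> hom (tensor_product R M N) (tensor_product R M' N)"
    and tensor_map_pure: "\<And>x y. x \<in> carrier M \<Longrightarrow> y \<in> carrier N \<Longrightarrow>
      tensor_map R a M' N (pure_tensor R M N x y) = pure_tensor R M' N (a x) y"
proof -
  interpret A: module_pair R M N using assms by (simp add: module_pair_def)
  interpret B: module_pair R M' N using assms by (simp add: module_pair_def)
  note aD = module_homsD[OF a]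
  obtain h where h: "h \<in> hom A.T B.T"
    "\<And>x y. x \<in> carrier M \<Longrightarrow> y \<in> carrier N \<Longrightarrow> h (A.pure x y) = B.pure (a x) y"
  proof (rule A.tensor_universal[OF B.T.comm_group_axioms, of "\<lambda>x y. B.pure (a x) y"])
  qed (auto simp: aD B.pure_add_left B.pure_add_right B.pure_balanced)
  let ?e = "frag_extend (\<lambda>(x, y). frag_of (a x, y))"
  have eq: "h (A.K #>\<^bsub>A.F\<^esub> c) = B.K #>\<^bsub>B.F\<^esub> ?e c" and ec: "?e c \<in> carrier B.F"
    if "Poly_Mapping.keys c \<subseteq> carrier M \<times> carrier N" for c
  proof -
    interpret h: group_hom A.T B.T h using h by unfold_locales
    interpret ca: group_hom A.F A.T "\<lambda>c. A.K #>\<^bsub>A.F\<^esub> c" by unfold_locales (rule A.coset_hom)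
    interpret cb: group_hom B.F B.T "\<lambda>c. B.K #>\<^bsub>B.F\<^esub> c" by unfold_locales (rule B.coset_hom)
    have "h (A.K #>\<^bsub>A.F\<^esub> c) = B.K #>\<^bsub>B.F\<^esub> ?e c \<and> ?e c \<in> carrier B.F"
      using that
    proof (induction rule: free_Abelian_group_induct [consumes 1, case_names zero diff of])
      case zero
      show ?case using h.hom_one ca.hom_one cb.hom_one by simp
    next
      case (diff x y)
      have 3: "x - y = x \<otimes>\<^bsub>A.F\<^esub> inv\<^bsub>A.F\<^esub> y" "x \<in> carrier A.F" "y \<in> carrier A.F"
        using diff by simp_all
      have 4: "?e (x - y) = ?e x \<otimes>\<^bsub>B.F\<^esub> inv\<^bsub>B.F\<^esub> ?e y"
        using diff by (simp add: frag_extend_diff)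
      show ?case
        unfolding 3(1) 4[unfolded 3(1)]
        using diff 3(2,3) ca.hom_closed[of x] ca.hom_closed[of y]
        by (simp del: carrier_free_Abelian_group_iff mult_free_Abelian_group inv_free_Abelian_group)
    next
      case (of p)
      then show ?case using h(2) aD by (cases p) (auto simp: pure_tensor_def)
    qed
    then show "h (A.K #>\<^bsub>A.F\<^esub> c) = B.K #>\<^bsub>B.F\<^esub> ?e c" "?e c \<in> carrier B.F" by auto
  qed
  have tm: "tensor_map R a M' N t = h t" if t: "t \<in> carrier A.T" for t
  proof -
    obtain c where c: "Poly_Mapping.keys c \<subseteq> carrier M \<times> carrier N" "t = A.K #>\<^bsub>A.F\<^esub> c"
      using t unfolding tensor_product_def carrier_FactGroup by auto
    have cc: "c \<in> carrier A.F" using c by simp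
    \<comment> \<open>Nonemptiness of the coset: its image is then exactly the singleton
      \<open>{h t}\<close>.\<close>
    have self: "c \<in> t" unfolding c(2) by (rule A.F.rcos_self[OF cc A.subgroup_tensor_kernel])
    have const: "B.K #>\<^bsub>B.F\<^esub> ?e d = h t" if "d \<in> t" for d
    proof -
      have "t = A.K #>\<^bsub>A.F\<^esub> d"
        using A.F.repr_independence[OF _ cc A.subgroup_tensor_kernel] that c(2) by blast
      moreover have "d \<in> carrier A.F"
        using that c(2) cc subgroup.elemrcos_carrier[OF A.subgroup_tensor_kernel A.F.is_group] by blast
      ultimately show ?thesis using eq by simp
    qed
    have "(\<lambda>d. B.K #>\<^bsub>B.F\<^esub> ?e d) ` t = {h t}" using const self by (auto intro!: image_eqI[of _ _ c])
    then show ?thesis unfolding tensor_map_def by simp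
  qed
  show "tensor_map R a M' N \<in> hom A.T B.T"
    using h(1) tm unfolding hom_def by auto
  show "tensor_map R a M' N (A.pure x y) = B.pure (a x) y" if "x \<in> carrier M" "y \<in> carrier N" for x y
    using that by (simp add: tm h(2))
qed

section \<open>Dual bases\<close>

lemma ideal_module_simps [simp]:
  "carrier (ideal_module R I) = I" "add (ideal_module R I) = add R"
  "\<zero>\<^bsub>ideal_module R I\<^esub> = \<zero>\<^bsub>R\<^esub>" "smult (ideal_module R I) = monoid.mult R"
  by (simp_all add: ideal_module_def)

lemma restrict_scalars_simps [simp]:
  "carrier (restrict_scalars S h) = carrier S" "add (restrict_scalars S h) = add S"
  "\<zero>\<^bsub>restrict_scalars S h\<^esub> = \<zero>\<^bsub>S\<^esub>"
  "r \<odot>\<^bsub>restrict_scalars S h\<^esub> s = h r \<otimes>\<^bsub>S\<^esub> s"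
  by (simp_all add: restrict_scalars_def)

lemma (in cring) module_ideal_module:
  assumes "ideal I R"
  shows "module R (ideal_module R I)"
proof -
  interpret I: ideal I R by fact
  note sub = I.Icarr
  have "abelian_group (ideal_module R I)"
    by (rule abelian_groupI)
       (use sub I.a_closed I.a_inv_closed in \<open>auto simp: a_ac intro!: bexI[of _ "\<ominus> _"] l_neg r_neg\<close>)
  then show ?thesis
    by (intro moduleI)
       (use sub I.I_l_closed in \<open>auto simp: l_distr r_distr m_assoc is_cring\<close>)
qed

lemma (in cring) module_regular: "module R (regular_module R)"
  by (rule module_ideal_module[OF oneideal])

lemma module_restrict_scalars:
  assumes "cring R" "ring S" "h \<in> ring_hom R S"
  shows "module R (restrict_scalars S h)"
proof -
  interpret R: cring R by fact
  interpret S: ring S by fact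
  have "abelian_group (restrict_scalars S h)"
    by (rule abelian_groupI)
       (auto simp: S.a_ac intro!: bexI[of _ "\<ominus>\<^bsub>S\<^esub> _"] S.l_neg)
  then show ?thesis
    by (intro moduleI)
       (use assms in \<open>auto simp: S.l_distr S.r_distr S.m_assoc ring_hom_closed ring_hom_add
          ring_hom_mult ring_hom_one\<close>)
qed

section \<open>Calculus of module homomorphisms\<close>

lemma module_homsI:
  assumes "\<And>x. x \<in> carrier M \<Longrightarrow> f x \<in> carrier N"
    and "\<And>x y. x \<in> carrier M \<Longrightarrow> y \<in> carrier M \<Longrightarrow> f (x \<oplus>\<^bsub>M\<^esub> y) = f x \<oplus>\<^bsub>N\<^esub> f y"
    and "\<And>r x. r \<in> carrier R \<Longrightarrow> x \<in> carrier M \<Longrightarrow> f (r \<odot>\<^bsub>M\<^esub> x) = r \<odot>\<^bsub>N\<^esub> f x"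
    and "module R M"
  shows "restrict f (carrier M) \<in> module_homs R M N"
proof -
  interpret M: module R M by fact
  show ?thesis using assms unfolding module_homs_def by auto
qed

lemma module_homs_zero:
  assumes "f \<in> module_homs R M N" "module R M" "module R N"
  shows "f \<zero>\<^bsub>M\<^esub> = \<zero>\<^bsub>N\<^esub>"
proof -
  interpret M: module R M by fact
  interpret N: module R N by fact
  show ?thesis
    using module_homsD(3)[OF assms(1), of "\<zero>\<^bsub>M\<^esub>" "\<zero>\<^bsub>M\<^esub>"] module_homsD(2)[OF assms(1), of "\<zero>\<^bsub>M\<^esub>"]
      N.add.l_cancel_one' by simp
qed

lemma module_homs_minus:
  assumes "f \<in> module_homs R M N" "module R M" "module R N" "x \<in> carrier M"
  shows "f (\<ominus>\<^bsub>M\<^esub> x) = \<ominus>\<^bsub>N\<^esub> f x"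
proof -
  interpret M: module R M by fact
  interpret N: module R N by fact
  have "f (\<ominus>\<^bsub>M\<^esub> x) \<oplus>\<^bsub>N\<^esub> f x = \<zero>\<^bsub>N\<^esub>"
    using module_homsD(3)[OF assms(1), of "\<ominus>\<^bsub>M\<^esub> x" x] module_homs_zero[OF assms(1-3)] assms(4)
      M.l_neg by simp
  then show ?thesis using module_homsD(2)[OF assms(1)] assms(4) N.minus_equality by simp
qed

lemma module_homs_finsum:
  assumes "f \<in> module_homs R M N" "module R M" "module R N" "finite A" "g \<in> A \<rightarrow> carrier M"
  shows "f (finsum M g A) = finsum N (\<lambda>i. f (g i)) A"
proof -
  interpret M: module R M by fact
  interpret N: module R N by fact
  note D = module_homsD[OF assms(1)]
  show ?thesis
    using assms(4,5)
  proof induction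
    case empty
    show ?case by (simp add: module_homs_zero[OF assms(1-3)])
  next
    case (insert i A)
    then show ?case
      by (subst M.finsum_insert N.finsum_insert; auto simp: D Pi_iff M.finsum_closed)+
  qed
qed

text \<open>With a dual basis of M this turns arbitrary choices \<open>t b\<close> into a
  homomorphism; the splitting maps of a presentation arise in this way.\<close>

lemma lincomb_module_homs:
  assumes "module R M" "module R N" "finite B"
    and c: "\<And>b. b \<in> B \<Longrightarrow> c b \<in> module_homs R M (regular_module R)"
    and t: "t \<in> B \<rightarrow> carrier N"
  shows "(\<lambda>x\<in>carrier M. finsum N (\<lambda>b. c b x \<odot>\<^bsub>N\<^esub> t b) B) \<in> module_homs R M N"
proof -
  interpret M: module R M by fact
  interpret N: module R N by fact
  note cD = module_homsD[OF c, simplified]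
  have t': "b \<in> B \<Longrightarrow> t b \<in> carrier N" for b using t by auto
  show ?thesis
  proof (rule module_homsI)
    show "finsum N (\<lambda>b. c b (x \<oplus>\<^bsub>M\<^esub> y) \<odot>\<^bsub>N\<^esub> t b) B =
      finsum N (\<lambda>b. c b x \<odot>\<^bsub>N\<^esub> t b) B \<oplus>\<^bsub>N\<^esub> finsum N (\<lambda>b. c b y \<odot>\<^bsub>N\<^esub> t b) B"
      if xy: "x \<in> carrier M" "y \<in> carrier M" for x y
    proof -
      have "finsum N (\<lambda>b. c b (x \<oplus>\<^bsub>M\<^esub> y) \<odot>\<^bsub>N\<^esub> t b) B =
          finsum N (\<lambda>b. c b x \<odot>\<^bsub>N\<^esub> t b \<oplus>\<^bsub>N\<^esub> c b y \<odot>\<^bsub>N\<^esub> t b) B"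
        by (rule N.finsum_cong') (use xy in \<open>auto simp: cD t' N.smult_l_distr\<close>)
      also have "\<dots> = finsum N (\<lambda>b. c b x \<odot>\<^bsub>N\<^esub> t b) B \<oplus>\<^bsub>N\<^esub> finsum N (\<lambda>b. c b y \<odot>\<^bsub>N\<^esub> t b) B"
        by (rule N.finsum_addf) (use xy in \<open>auto simp: cD t'\<close>)
      finally show ?thesis .
    qed
    show "finsum N (\<lambda>b. c b (r \<odot>\<^bsub>M\<^esub> x) \<odot>\<^bsub>N\<^esub> t b) B = r \<odot>\<^bsub>N\<^esub> finsum N (\<lambda>b. c b x \<odot>\<^bsub>N\<^esub> t b) B"
      if "r \<in> carrier R" "x \<in> carrier M" for r x
      by (subst N.finsum_smult_ldistr)
         (use that assms in \<open>auto intro!: N.finsum_cong' simp: cD t' N.smult_assoc1\<close>)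
  qed (use assms in \<open>auto intro!: N.finsum_closed simp: cD t'\<close>)
qed

section \<open>Coordinates on free modules and dual bases\<close>

lemma free_module_simps [simp]:
  "\<zero>\<^bsub>free_module R B\<^esub> = (\<lambda>x. \<zero>\<^bsub>R\<^esub>)"
  "f \<oplus>\<^bsub>free_module R B\<^esub> g = (\<lambda>x. f x \<oplus>\<^bsub>R\<^esub> g x)"
  "r \<odot>\<^bsub>free_module R B\<^esub> f = (\<lambda>x. r \<otimes>\<^bsub>R\<^esub> f x)"
  by (simp_all add: free_module_def)

lemma free_module_carrier:
  "f \<in> carrier (free_module R B) \<longleftrightarrow>
     (\<forall>x\<in>B. f x \<in> carrier R) \<and> (\<forall>x. x \<notin> B \<longrightarrow> f x = \<zero>\<^bsub>R\<^esub>) \<and> finite {x. f x \<noteq> \<zero>\<^bsub>R\<^esub>}"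
  by (simp add: free_module_def)

text \<open>Induction on a finite set containing the support of f: split off the coordinate at one
  basis element and apply the homomorphism to both parts. The argument needs only the laws of p,
  never the module axioms for the free module.\<close>

lemma free_module_hom_expansion:
  assumes "module R M" and p: "p \<in> module_homs R (free_module R B) M"
    and "finite B0" "B0 \<subseteq> B"
    and f: "f \<in> carrier (free_module R B)" "\<And>b. b \<notin> B0 \<Longrightarrow> f b = \<zero>\<^bsub>R\<^esub>"
  shows "p f = finsum M (\<lambda>b. f b \<odot>\<^bsub>M\<^esub> p (\<lambda>x. if x = b then \<one>\<^bsub>R\<^esub> else \<zero>\<^bsub>R\<^esub>)) B0"
  using assms(3-)
proof (induction B0 arbitrary: f)
  interpret M: module R M by fact
  note pD = module_homsD[OF p]
  let ?d = "\<lambda>b x. if x = b then \<one>\<^bsub>R\<^esub> else \<zero>\<^bsub>R\<^esub>"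
  have dc: "?d b \<in> carrier (free_module R B)" if "b \<in> B" for b
  proof -
    have "finite {x. ?d b x \<noteq> \<zero>\<^bsub>R\<^esub>}" by (rule finite_subset[of _ "{b}"]) auto
    then show ?thesis using that by (auto simp: free_module_carrier)
  qed
  {
    case empty
    then have "f = (\<lambda>x. \<zero>\<^bsub>R\<^esub>)" by auto
    moreover have "p (\<lambda>x. \<zero>\<^bsub>R\<^esub>) = p (\<lambda>x. \<zero>\<^bsub>R\<^esub>) \<oplus>\<^bsub>M\<^esub> p (\<lambda>x. \<zero>\<^bsub>R\<^esub>)" "p (\<lambda>x. \<zero>\<^bsub>R\<^esub>) \<in> carrier M"
      using pD(3)[of f f] pD(2)[of f] empty \<open>f = (\<lambda>x. \<zero>\<^bsub>R\<^esub>)\<close> by simp_all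
    ultimately show ?case using M.M.add.l_cancel_one' by simp
  next
    case (insert b B0)
    let ?g = "f(b := \<zero>\<^bsub>R\<^esub>)"
    have fc: "f x \<in> carrier R" for x
      using insert.prems(2) by (cases "x \<in> B") (auto simp: free_module_carrier)
    have gc: "?g \<in> carrier (free_module R B)"
    proof -
      have "finite {x. ?g x \<noteq> \<zero>\<^bsub>R\<^esub>}"
        by (rule finite_subset[of _ "{x. f x \<noteq> \<zero>\<^bsub>R\<^esub>}"])
           (use insert.prems(2) in \<open>auto simp: free_module_carrier\<close>)
      then show ?thesis using insert.prems(2) by (auto simp: free_module_carrier)
    qed
    have hc: "(\<lambda>x. f b \<otimes>\<^bsub>R\<^esub> ?d b x) \<in> carrier (free_module R B)"
    proof -
      have "finite {x. f b \<otimes>\<^bsub>R\<^esub> ?d b x \<noteq> \<zero>\<^bsub>R\<^esub>}"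
        by (rule finite_subset[of _ "{b}"]) (auto simp: fc)
      then show ?thesis using insert.prems(1) by (auto simp: free_module_carrier fc)
    qed
    have "f = (\<lambda>x. ?g x \<oplus>\<^bsub>R\<^esub> f b \<otimes>\<^bsub>R\<^esub> ?d b x)"
      using fc by (auto simp: fun_eq_iff)
    then have "p f = p ?g \<oplus>\<^bsub>M\<^esub> p (\<lambda>x. f b \<otimes>\<^bsub>R\<^esub> ?d b x)"
      using pD(3)[OF gc hc] by simp
    also have "p (\<lambda>x. f b \<otimes>\<^bsub>R\<^esub> ?d b x) = f b \<odot>\<^bsub>M\<^esub> p (?d b)"
      using pD(4)[OF fc[of b] dc[of b]] insert.prems(1) by simp
    also have "p ?g = finsum M (\<lambda>b'. ?g b' \<odot>\<^bsub>M\<^esub> p (?d b')) B0"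
      by (rule insert.IH[OF _ gc]) (use insert.prems in auto)
    also have "\<dots> = finsum M (\<lambda>b'. f b' \<odot>\<^bsub>M\<^esub> p (?d b')) B0"
      by (rule M.M.finsum_cong') (use insert fc in \<open>auto intro!: pD(2) dc\<close>)
    also have "\<dots> \<oplus>\<^bsub>M\<^esub> f b \<odot>\<^bsub>M\<^esub> p (?d b) = finsum M (\<lambda>b. f b \<odot>\<^bsub>M\<^esub> p (?d b)) (insert b B0)"
    proof -
      have "f b' \<odot>\<^bsub>M\<^esub> p (?d b') \<in> carrier M" if "b' \<in> insert b B0" for b'
        using that insert.prems(1) by (intro M.smult_closed fc pD(2) dc) auto
      then show ?thesis
        using insert.hyps by (subst M.M.finsum_insert) (auto intro!: M.M.a_comm M.M.finsum_closed)
    qed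
    finally show ?case .
  }
qed

lemma module_span_induct:
  assumes "x \<in> module_span R M A" "submodule {x \<in> carrier M. Pr x} R M" "A \<subseteq> carrier M"
    "\<And>x. x \<in> A \<Longrightarrow> Pr x"
  shows "Pr x"
  using assms unfolding module_span_def by auto

text \<open>The coordinate form of being finitely generated and projective: M is a retract of a free
  module on the finite set \<open>B\<close>, with the \<open>c b\<close> as the coordinates of the
  inclusion and the \<open>e b\<close> as the images of the unit vectors.\<close>

definition dual_basis ::
  "('a, 'm) ring_scheme \<Rightarrow> ('a, 'b) module \<Rightarrow> 'i set \<Rightarrow> ('i \<Rightarrow> 'b) \<Rightarrow> ('i \<Rightarrow> 'b \<Rightarrow> 'a) \<Rightarrow> bool" where
  "dual_basis R M B e c \<longleftrightarrow> finite B \<and> (\<forall>b\<in>B. e b \<in> carrier M \<and> c b \<in> module_homs R M (regular_module R)) \<and>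
     (\<forall>x\<in>carrier M. finsum M (\<lambda>b. c b x \<odot>\<^bsub>M\<^esub> e b) B = x)"

lemma dual_basisD:
  assumes "dual_basis R M B e c"
  shows "finite B" "b \<in> B \<Longrightarrow> e b \<in> carrier M"
    "b \<in> B \<Longrightarrow> c b \<in> module_homs R M (regular_module R)"
    "x \<in> carrier M \<Longrightarrow> finsum M (\<lambda>b. c b x \<odot>\<^bsub>M\<^esub> e b) B = x"
  using assms by (auto simp: dual_basis_def)

text \<open>The free module of which M is a retract may have an infinite basis, but finitely many
  generators of M involve only finitely many coordinates, and then so does all of M.\<close>

lemma fg_projective_dual_basis:
  fixes M :: "('a, 'b) module"
  assumes fg: "finitely_generated_module R M" and "projective_module R M"
  shows "\<exists>(B :: 'b set) e c. dual_basis R M B e c"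
proof -
  interpret M: module R M using fg by (simp add: finitely_generated_module_def)
  obtain B :: "'b set" and i p where i: "i \<in> module_homs R M (free_module R B)"
    and p: "p \<in> module_homs R (free_module R B) M" and pi: "\<And>x. x \<in> carrier M \<Longrightarrow> p (i x) = x"
    using assms(2) unfolding projective_module_def by blast
  obtain A where A: "finite A" "A \<subseteq> carrier M" "module_span R M A = carrier M"
    using fg unfolding finitely_generated_module_def by blast
  note iD = module_homsD[OF i] and pD = module_homsD[OF p]
  let ?d = "\<lambda>b x. if x = b then \<one>\<^bsub>R\<^esub> else \<zero>\<^bsub>R\<^esub>"
  define B0 where "B0 = (\<Union>x\<in>A. {b. i x b \<noteq> \<zero>\<^bsub>R\<^esub>})"
  have ix: "i x \<in> carrier (free_module R B)" if "x \<in> carrier M" for x using iD(2) that .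
  have ixc: "i x b \<in> carrier R" if "x \<in> carrier M" for x b
    using ix[OF that] by (cases "b \<in> B") (auto simp: free_module_carrier)
  have B0: "finite B0" "B0 \<subseteq> B"
    using A ix unfolding B0_def by (auto simp: free_module_carrier)
  have i0: "i \<zero>\<^bsub>M\<^esub> = (\<lambda>x. \<zero>\<^bsub>R\<^esub>)"
    using iD(4)[of "\<zero>\<^bsub>R\<^esub>" "\<zero>\<^bsub>M\<^esub>"] ixc by simp
  \<comment> \<open>Vanishing of the coordinates outside \<open>B0\<close> defines a submodule, and
    it holds for the generators by the choice of \<open>B0\<close>.\<close>
  have van: "\<forall>b. b \<notin> B0 \<longrightarrow> i x b = \<zero>\<^bsub>R\<^esub>" if "x \<in> carrier M" for x
  proof (rule module_span_induct[of x R M A])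
    show "submodule {x \<in> carrier M. \<forall>b. b \<notin> B0 \<longrightarrow> i x b = \<zero>\<^bsub>R\<^esub>} R M"
    proof (rule M.submoduleI)
      fix x assume x: "x \<in> {x \<in> carrier M. \<forall>b. b \<notin> B0 \<longrightarrow> i x b = \<zero>\<^bsub>R\<^esub>}"
      have "i (\<ominus>\<^bsub>M\<^esub> x) b = \<zero>\<^bsub>R\<^esub>" if "b \<notin> B0" for b
      proof -
        have "i x b \<oplus>\<^bsub>R\<^esub> i (\<ominus>\<^bsub>M\<^esub> x) b = i (x \<oplus>\<^bsub>M\<^esub> \<ominus>\<^bsub>M\<^esub> x) b"
          using iD(3)[of x "\<ominus>\<^bsub>M\<^esub> x"] x by simp
        also have "\<dots> = \<zero>\<^bsub>R\<^esub>" using x by (simp add: M.M.r_neg i0)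
        finally show ?thesis using x that ixc[of "\<ominus>\<^bsub>M\<^esub> x" b] by simp
      qed
      then show "\<ominus>\<^bsub>M\<^esub> x \<in> {x \<in> carrier M. \<forall>b. b \<notin> B0 \<longrightarrow> i x b = \<zero>\<^bsub>R\<^esub>}"
        using x by simp
    qed (auto simp: i0 iD ixc)
  qed (use that A B0_def in auto)
  have d: "?d b \<in> carrier (free_module R B)" if "b \<in> B0" for b
  proof -
    have "finite {x. ?d b x \<noteq> \<zero>\<^bsub>R\<^esub>}" by (rule finite_subset[of _ "{b}"]) auto
    then show ?thesis using that B0 by (auto simp: free_module_carrier)
  qed
  have lin: "(\<lambda>x\<in>carrier M. i x b) \<in> module_homs R M (regular_module R)" for b
    by (rule module_homsI) (use iD ixc M.module_axioms in auto)
  have "finsum M (\<lambda>b. (\<lambda>x\<in>carrier M. i x b) x \<odot>\<^bsub>M\<^esub> p (?d b)) B0 = x" if x: "x \<in> carrier M" for x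
    using free_module_hom_expansion[OF M.module_axioms p B0 ix[OF x]] van[OF x] pi[OF x] x by simp
  then have "dual_basis R M B0 (\<lambda>b. p (?d b)) (\<lambda>b. \<lambda>x\<in>carrier M. i x b)"
    using B0(1) lin pD(2)[OF d] by (simp add: dual_basis_def)
  then show ?thesis by blast
qed

section \<open>Presentations of cyclic modules\<close>

definition (in module) annihilator :: "'c \<Rightarrow> 'a set" where
  "annihilator m = {r \<in> carrier R. r \<odot>\<^bsub>M\<^esub> m = \<zero>\<^bsub>M\<^esub>}"

lemma (in module) ideal_annihilator:
  assumes "m \<in> carrier M"
  shows "ideal (annihilator m) R"
proof (rule idealI[OF R.ring_axioms])
  show "subgroup (annihilator m) (add_monoid R)"
  proof
    fix x assume "x \<in> annihilator m"
    then show "inv\<^bsub>add_monoid R\<^esub> x \<in> annihilator m"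
      using assms by (auto simp: annihilator_def smult_l_minus simp flip: a_inv_def)
  qed (use assms in \<open>auto simp: annihilator_def smult_l_distr\<close>)
  show l: "x \<otimes> r \<in> annihilator m" if "r \<in> annihilator m" "x \<in> carrier R" for r x
    using assms that by (simp add: annihilator_def smult_assoc1)
  show "r \<otimes> x \<in> annihilator m" if "r \<in> annihilator m" "x \<in> carrier R" for r x
    using l[OF that] that by (simp add: annihilator_def R.m_comm)
qed

text \<open>
  For a presentation of a cyclic module \<open>R/I\<close> by projectives \<open>P\<close> and \<open>Q\<close>, with \<open>q0\<close> a lift of the generator:
  \<open>(\<sigma>, \<tau>)\<close> splits the surjection from \<open>R \<oplus> P\<close> to \<open>Q\<close> sending \<open>(r, x)\<close> to \<open>r q0 + a x\<close>, and
  \<open>\<beta>\<close> is the map from \<open>I\<close> to \<open>P\<close> induced by \<open>r \<mapsto> r q0\<close>.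
\<close>

locale split_presentation = P: module R P + Q: module R Q
  for R :: "('a, 'm) ring_scheme" and P :: "('a, 'c) module" and Q :: "('a, 'd) module" +
  fixes a :: "'c \<Rightarrow> 'd" and I :: "'a set" and q0 :: 'd
    and \<sigma> :: "'d \<Rightarrow> 'a" and \<tau> :: "'d \<Rightarrow> 'c" and \<beta> :: "'a \<Rightarrow> 'c"
  assumes ideal_I: "ideal I R"
    and a_hom: "a \<in> module_homs R P Q"
    and q0 [simp, intro]: "q0 \<in> carrier Q"
    and \<sigma>_hom: "\<sigma> \<in> module_homs R Q (regular_module R)"
    and \<tau>_hom: "\<tau> \<in> module_homs R Q P"
    and \<beta>_hom: "\<beta> \<in> module_homs R (ideal_module R I) P"
    and split: "q \<in> carrier Q \<Longrightarrow> \<sigma> q \<odot>\<^bsub>Q\<^esub> q0 \<oplus>\<^bsub>Q\<^esub> a (\<tau> q) = q"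
    and a_\<beta>: "x \<in> I \<Longrightarrow> a (\<beta> x) = x \<odot>\<^bsub>Q\<^esub> q0"
    and \<sigma>_a_mem: "y \<in> carrier P \<Longrightarrow> \<sigma> (a y) \<in> I"
    and compl_mem: "\<one>\<^bsub>R\<^esub> \<ominus>\<^bsub>R\<^esub> \<sigma> q0 \<in> I"
    and split_P: "y \<in> carrier P \<Longrightarrow> \<beta> (\<sigma> (a y)) \<oplus>\<^bsub>P\<^esub> \<tau> (a y) = y"

text \<open>As m generates M, the elements \<open>q0\<close> and \<open>a\<close> of P together
  generate Q; projectivity of Q splits this surjection. The remaining data come from exactness and
  from injectivity of \<open>a\<close>.\<close>

lemma split_presentation_exists:
  fixes Q :: "('a, 'd) module"
  assumes "cring R" "module R M" and pres: "fg_projective_presentation R P Q M a p"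
    and m: "m \<in> carrier M" "\<And>x. x \<in> carrier M \<Longrightarrow> \<exists>r\<in>carrier R. x = r \<odot>\<^bsub>M\<^esub> m"
  obtains q0 \<sigma> \<tau> \<beta> where "split_presentation R P Q a (module.annihilator R M m) q0 \<sigma> \<tau> \<beta>"
proof -
  interpret R: cring R by fact
  interpret M: module R M by fact
  have fg: "finitely_generated_module R P" "finitely_generated_module R Q" "projective_module R Q"
    and ah: "a \<in> module_homs R P Q" and ph: "p \<in> module_homs R Q M"
    and inj: "inj_on a (carrier P)" and ker: "a ` carrier P = a_kernel Q M p"
    and surj: "p ` carrier Q = carrier M"
    using pres unfolding fg_projective_presentation_def by auto
  interpret P: module R P using fg by (simp add: finitely_generated_module_def)
  interpret Q: module R Q using fg by (simp add: finitely_generated_module_def)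
  note aD = module_homsD[OF ah] and pD = module_homsD[OF ph]
  have ker': "q \<in> a ` carrier P \<longleftrightarrow> q \<in> carrier Q \<and> p q = \<zero>\<^bsub>M\<^esub>" for q
    unfolding ker a_kernel_def' by auto
  have pa: "p (a y) = \<zero>\<^bsub>M\<^esub>" if "y \<in> carrier P" for y using ker'[of "a y"] that by auto
  obtain q0 where q0: "q0 \<in> carrier Q" "p q0 = m" using m(1) unfolding surj[symmetric] by auto
  obtain B :: "'d set" and e c where db: "dual_basis R Q B e c"
    using fg_projective_dual_basis[OF fg(2,3)] by blast
  note B = dual_basisD(1,2)[OF db] and c = dual_basisD(3)[OF db] and dual = dual_basisD(4)[OF db]
  note cD = module_homsD[OF c, simplified]
  \<comment> \<open>The image of \<open>e b\<close> in M is a multiple k of m, so \<open>e b\<close>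
    minus k times \<open>q0\<close> lies in the kernel of p, which is the image of
    \<open>a\<close>.\<close>
  have "\<exists>k d. k \<in> carrier R \<and> d \<in> carrier P \<and> e b = k \<odot>\<^bsub>Q\<^esub> q0 \<oplus>\<^bsub>Q\<^esub> a d" if b: "b \<in> B" for b
  proof -
    have eb: "e b \<in> carrier Q" using B b by auto
    obtain k where k: "k \<in> carrier R" "p (e b) = k \<odot>\<^bsub>M\<^esub> m" using m(2)[OF pD(2)[OF eb]] by auto
    have "p (e b \<oplus>\<^bsub>Q\<^esub> \<ominus>\<^bsub>Q\<^esub> (k \<odot>\<^bsub>Q\<^esub> q0)) = \<zero>\<^bsub>M\<^esub>"
      using k eb q0 m(1) by (simp add: pD module_homs_minus[OF ph Q.module_axioms M.module_axioms] M.M.r_neg)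
    then obtain d where d: "d \<in> carrier P" "a d = e b \<oplus>\<^bsub>Q\<^esub> \<ominus>\<^bsub>Q\<^esub> (k \<odot>\<^bsub>Q\<^esub> q0)"
      using ker'[of "e b \<oplus>\<^bsub>Q\<^esub> \<ominus>\<^bsub>Q\<^esub> (k \<odot>\<^bsub>Q\<^esub> q0)"] eb k q0 by auto
    have "e b = k \<odot>\<^bsub>Q\<^esub> q0 \<oplus>\<^bsub>Q\<^esub> a d"
      unfolding d(2) using eb k q0 by (simp add: Q.M.a_ac Q.M.r_neg)
    then show ?thesis using k(1) d(1) by blast
  qed
  then obtain k d where kd: "\<And>b. b \<in> B \<Longrightarrow> k b \<in> carrier R" "\<And>b. b \<in> B \<Longrightarrow> d b \<in> carrier P"
    "\<And>b. b \<in> B \<Longrightarrow> e b = k b \<odot>\<^bsub>Q\<^esub> q0 \<oplus>\<^bsub>Q\<^esub> a (d b)" by metis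
  \<comment> \<open>The pairs \<open>k b\<close>, \<open>d b\<close> are unrelated choices, one for
    each element of the dual basis; weighting them with the coordinates of q makes the choice linear
    in q.\<close>
  define \<sigma> where "\<sigma> = (\<lambda>x\<in>carrier Q. finsum (regular_module R) (\<lambda>b. c b x \<odot>\<^bsub>regular_module R\<^esub> k b) B)"
  define \<tau> where "\<tau> = (\<lambda>x\<in>carrier Q. finsum P (\<lambda>b. c b x \<odot>\<^bsub>P\<^esub> d b) B)"
  have s: "\<sigma> \<in> module_homs R Q (regular_module R)" unfolding \<sigma>_def
    by (rule lincomb_module_homs[OF Q.module_axioms R.module_regular B(1) c]) (use kd in auto)
  have t: "\<tau> \<in> module_homs R Q P" unfolding \<tau>_def
    by (rule lincomb_module_homs[OF Q.module_axioms P.module_axioms B(1) c]) (use kd in auto)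
  note sD = module_homsD[OF s, simplified] and tD = module_homsD[OF t]
  have split: "\<sigma> q \<odot>\<^bsub>Q\<^esub> q0 \<oplus>\<^bsub>Q\<^esub> a (\<tau> q) = q" if q: "q \<in> carrier Q" for q
  proof -
    have g: "(\<lambda>r\<in>carrier (regular_module R). r \<odot>\<^bsub>Q\<^esub> q0) \<in> module_homs R (regular_module R) Q"
      by (rule module_homsI[OF _ _ _ R.module_regular]) (use q0 in \<open>auto simp: Q.smult_l_distr Q.smult_assoc1\<close>)
    have "\<sigma> q \<odot>\<^bsub>Q\<^esub> q0 = (\<lambda>r\<in>carrier (regular_module R). r \<odot>\<^bsub>Q\<^esub> q0) (\<sigma> q)"
      using sD(2)[OF q] by simp
    also have "\<dots> = finsum Q (\<lambda>b. (\<lambda>r\<in>carrier (regular_module R). r \<odot>\<^bsub>Q\<^esub> q0) (c b q \<odot>\<^bsub>regular_module R\<^esub> k b)) B"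
      unfolding \<sigma>_def restrict_apply'[OF q]
      by (rule module_homs_finsum[OF g R.module_regular Q.module_axioms B(1)]) (use kd cD q in auto)
    also have "\<dots> = finsum Q (\<lambda>b. c b q \<odot>\<^bsub>Q\<^esub> (k b \<odot>\<^bsub>Q\<^esub> q0)) B"
      by (rule Q.M.finsum_cong') (use kd cD q q0 in \<open>auto simp: Q.smult_assoc1\<close>)
    finally have 1: "\<sigma> q \<odot>\<^bsub>Q\<^esub> q0 = finsum Q (\<lambda>b. c b q \<odot>\<^bsub>Q\<^esub> (k b \<odot>\<^bsub>Q\<^esub> q0)) B" .
    have "a (\<tau> q) = finsum Q (\<lambda>b. a (c b q \<odot>\<^bsub>P\<^esub> d b)) B"
      unfolding \<tau>_def restrict_apply'[OF q]
      by (rule module_homs_finsum[OF ah P.module_axioms Q.module_axioms B(1)]) (use kd cD q in auto)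
    also have "\<dots> = finsum Q (\<lambda>b. c b q \<odot>\<^bsub>Q\<^esub> a (d b)) B"
      by (rule Q.M.finsum_cong') (use kd cD q in \<open>auto simp: aD\<close>)
    finally have 2: "a (\<tau> q) = finsum Q (\<lambda>b. c b q \<odot>\<^bsub>Q\<^esub> a (d b)) B" .
    have "\<sigma> q \<odot>\<^bsub>Q\<^esub> q0 \<oplus>\<^bsub>Q\<^esub> a (\<tau> q) = finsum Q (\<lambda>b. c b q \<odot>\<^bsub>Q\<^esub> (k b \<odot>\<^bsub>Q\<^esub> q0) \<oplus>\<^bsub>Q\<^esub> c b q \<odot>\<^bsub>Q\<^esub> a (d b)) B"
      unfolding 1 2 by (rule Q.M.finsum_addf[symmetric]) (use kd cD q q0 aD in auto)
    also have "\<dots> = finsum Q (\<lambda>b. c b q \<odot>\<^bsub>Q\<^esub> e b) B"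
      by (rule Q.M.finsum_cong') (use kd cD q q0 aD B(2) in \<open>auto simp: Q.smult_r_distr\<close>)
    also have "\<dots> = q" by (rule dual[OF q])
    finally show ?thesis .
  qed
  have I: "ideal (M.annihilator m) R" by (rule M.ideal_annihilator[OF m(1)])
  have Ic: "x \<in> carrier R" "x \<odot>\<^bsub>M\<^esub> m = \<zero>\<^bsub>M\<^esub>" if "x \<in> M.annihilator m" for x
    using that by (auto simp: M.annihilator_def)
  \<comment> \<open>If x annihilates m, then x times \<open>q0\<close> maps to zero in M, so it has
    a preimage under \<open>a\<close>; injectivity makes the preimage unique and hence linear in
    x.\<close>
  define \<beta> where "\<beta> = (\<lambda>x\<in>carrier (ideal_module R (M.annihilator m)). inv_into (carrier P) a (x \<odot>\<^bsub>Q\<^esub> q0))"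
  have im: "x \<odot>\<^bsub>Q\<^esub> q0 \<in> a ` carrier P" if "x \<in> M.annihilator m" for x
    unfolding ker' using Ic[OF that] q0 by (simp add: pD)
  have b_cl: "\<beta> x \<in> carrier P" and ab: "a (\<beta> x) = x \<odot>\<^bsub>Q\<^esub> q0" if "x \<in> M.annihilator m" for x
    using inv_into_into[OF im[OF that]] f_inv_into_f[OF im[OF that]] that by (auto simp: \<beta>_def)
  have inj': "x = y" if "a x = a y" "x \<in> carrier P" "y \<in> carrier P" for x y
    using inj that by (auto dest: inj_onD)
  interpret I: ideal "M.annihilator m" R by fact
  have bh: "\<beta> \<in> module_homs R (ideal_module R (M.annihilator m)) P"
  proof -
    have "restrict \<beta> (carrier (ideal_module R (M.annihilator m))) \<in> module_homs R (ideal_module R (M.annihilator m)) P"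
    proof (rule module_homsI[OF _ _ _ R.module_ideal_module[OF I]])
      show "\<beta> (x \<oplus>\<^bsub>ideal_module R (M.annihilator m)\<^esub> y) = \<beta> x \<oplus>\<^bsub>P\<^esub> \<beta> y"
        if "x \<in> carrier (ideal_module R (M.annihilator m))" "y \<in> carrier (ideal_module R (M.annihilator m))" for x y
        by (rule inj') (use that q0 in \<open>simp_all add: ab b_cl aD Q.smult_l_distr Ic\<close>)
      show "\<beta> (r \<odot>\<^bsub>ideal_module R (M.annihilator m)\<^esub> x) = r \<odot>\<^bsub>P\<^esub> \<beta> x"
        if "r \<in> carrier R" "x \<in> carrier (ideal_module R (M.annihilator m))" for r x
        by (rule inj') (use that q0 in \<open>simp_all add: ab b_cl aD Q.smult_assoc1 Ic I.I_l_closed\<close>)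
    qed (auto simp: b_cl)
    moreover have "restrict \<beta> (carrier (ideal_module R (M.annihilator m))) = \<beta>"
      by (simp add: \<beta>_def)
    ultimately show ?thesis by simp
  qed
  \<comment> \<open>This is p applied to \<open>split\<close>. At q in the image of \<open>a\<close>
    it shows that \<open>\<sigma>\<close> takes P into the annihilator; at \<open>q0\<close> it
    shows that 1 minus \<open>\<sigma> q0\<close> lies there too.\<close>
  have psplit: "\<sigma> q \<odot>\<^bsub>M\<^esub> m = p q" if q: "q \<in> carrier Q" for q
  proof -
    have sq: "\<sigma> q \<in> carrier R" and tq: "a (\<tau> q) \<in> carrier Q" "p (a (\<tau> q)) = \<zero>\<^bsub>M\<^esub>"
      using sD(2)[OF q] tD(2)[OF q] aD(2) pa by auto
    have "p (\<sigma> q \<odot>\<^bsub>Q\<^esub> q0 \<oplus>\<^bsub>Q\<^esub> a (\<tau> q)) = \<sigma> q \<odot>\<^bsub>M\<^esub> m"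
      using pD(3)[OF Q.smult_closed[OF sq q0(1)] tq(1)] pD(4)[OF sq q0(1)] sq m(1) q0(2) tq(2) by simp
    then show ?thesis unfolding split[OF q] by (rule sym)
  qed
  have sa: "\<sigma> (a y) \<in> M.annihilator m" if y: "y \<in> carrier P" for y
    unfolding M.annihilator_def using psplit[OF aD(2)[OF y]] sD(2)[OF aD(2)[OF y]] pa[OF y] by simp
  have compl: "\<one>\<^bsub>R\<^esub> \<ominus>\<^bsub>R\<^esub> \<sigma> q0 \<in> M.annihilator m"
  proof -
    have sq: "\<sigma> q0 \<in> carrier R" by (rule sD(2)[OF q0(1)])
    have eq: "\<sigma> q0 \<odot>\<^bsub>M\<^esub> m = m" by (rule trans[OF psplit[OF q0(1)] q0(2)])
    have "(\<one>\<^bsub>R\<^esub> \<oplus>\<^bsub>R\<^esub> \<ominus>\<^bsub>R\<^esub> \<sigma> q0) \<odot>\<^bsub>M\<^esub> m = \<one>\<^bsub>R\<^esub> \<odot>\<^bsub>M\<^esub> m \<oplus>\<^bsub>M\<^esub> (\<ominus>\<^bsub>R\<^esub> \<sigma> q0) \<odot>\<^bsub>M\<^esub> m"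
      using sq m(1) by (intro M.smult_l_distr) auto
    also have "\<dots> = \<zero>\<^bsub>M\<^esub>"
      unfolding M.smult_l_minus[OF sq m(1)] eq M.smult_one[OF m(1)] by (rule M.M.r_neg[OF m(1)])
    finally show ?thesis using sq unfolding M.annihilator_def a_minus_def by blast
  qed
  \<comment> \<open>Both sides have the same image under the injective map \<open>a\<close>, by
    \<open>split\<close> at \<open>a y\<close>.\<close>
  have split_P: "\<beta> (\<sigma> (a y)) \<oplus>\<^bsub>P\<^esub> \<tau> (a y) = y" if y: "y \<in> carrier P" for y
  proof (rule inj')
    note ay = aD(2)[OF y]
    have "a (\<beta> (\<sigma> (a y)) \<oplus>\<^bsub>P\<^esub> \<tau> (a y)) = \<sigma> (a y) \<odot>\<^bsub>Q\<^esub> q0 \<oplus>\<^bsub>Q\<^esub> a (\<tau> (a y))"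
      using aD(3)[OF b_cl[OF sa[OF y]] tD(2)[OF ay]] ab[OF sa[OF y]] by (rule trans[OF _ arg_cong])
    then show "a (\<beta> (\<sigma> (a y)) \<oplus>\<^bsub>P\<^esub> \<tau> (a y)) = a y" unfolding split[OF ay] .
    show "\<beta> (\<sigma> (a y)) \<oplus>\<^bsub>P\<^esub> \<tau> (a y) \<in> carrier P"
      by (rule P.M.a_closed[OF b_cl[OF sa[OF y]] tD(2)[OF ay]])
  qed (rule y)
  show thesis
    by (rule that, rule split_presentation.intro[OF P.module_axioms Q.module_axioms
          split_presentation_axioms.intro[OF I ah q0(1) s t bh split ab sa compl split_P]])
qed

context split_presentation
begin

lemmas aD = module_homsD [OF a_hom]
  and \<sigma>D = module_homsD [OF \<sigma>_hom, simplified]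
  and \<tau>D = module_homsD [OF \<tau>_hom]
  and \<beta>D = module_homsD [OF \<beta>_hom, simplified]

sublocale I: ideal I R by (rule ideal_I)

lemma compl_add: "\<sigma> q0 \<oplus>\<^bsub>R\<^esub> (\<one>\<^bsub>R\<^esub> \<ominus>\<^bsub>R\<^esub> \<sigma> q0) = \<one>\<^bsub>R\<^esub>"
proof -
  have "\<sigma> q0 \<oplus>\<^bsub>R\<^esub> (\<one>\<^bsub>R\<^esub> \<oplus>\<^bsub>R\<^esub> \<ominus>\<^bsub>R\<^esub> \<sigma> q0) = (\<sigma> q0 \<oplus>\<^bsub>R\<^esub> \<ominus>\<^bsub>R\<^esub> \<sigma> q0) \<oplus>\<^bsub>R\<^esub> \<one>\<^bsub>R\<^esub>"
    using \<sigma>D(2)[OF q0] by (simp only: P.R.a_ac P.R.one_closed P.R.a_inv_closed)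
  then show ?thesis
    using \<sigma>D(2)[OF q0] unfolding a_minus_def by (simp add: P.R.r_neg)
qed

lemma \<sigma>_a_\<beta>: "x \<in> I \<Longrightarrow> \<sigma> (a (\<beta> x)) = x \<otimes>\<^bsub>R\<^esub> \<sigma> q0"
  using \<sigma>D(4)[OF I.Icarr q0] by (simp add: a_\<beta>)

text \<open>As a direct summand of R + P the ideal inherits finite generation. Explicitly, the
  projection to I sends 1 to 1 minus \<open>\<sigma> q0\<close> and y in P to
  \<open>\<sigma> (a y)\<close> up to sign, so this one element and the images of finitely many
  generators of P suffice.\<close>

lemma finitely_generated_I:
  assumes fg: "finitely_generated_module R P" "projective_module R P"
  shows "finitely_generated_ideal R I"
proof -
  obtain B :: "'c set" and e c where db: "dual_basis R P B e c"
    using fg_projective_dual_basis[OF fg] by blast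
  note B = dual_basisD(1,2)[OF db] and c = dual_basisD(3)[OF db] and dual = dual_basisD(4)[OF db]
  note cD = module_homsD[OF c, simplified]
  let ?A = "insert (\<one>\<^bsub>R\<^esub> \<ominus>\<^bsub>R\<^esub> \<sigma> q0) ((\<lambda>b. \<sigma> (a (e b))) ` B)"
  have AI: "?A \<subseteq> I" using B compl_mem \<sigma>_a_mem by auto
  have Ac: "?A \<subseteq> carrier R" using AI I.Icarr by blast
  have idl: "ideal (Idl\<^bsub>R\<^esub> ?A) R" by (rule P.R.genideal_ideal[OF Ac])
  interpret J: ideal "Idl\<^bsub>R\<^esub> ?A" R by (rule idl)
  have gen: "?A \<subseteq> Idl\<^bsub>R\<^esub> ?A" by (rule P.R.genideal_self[OF Ac])
  \<comment> \<open>Arbitrary coefficients and an arbitrary part of \<open>B\<close> are allowed so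
    that the induction on the index set goes through; it is used for the coordinates of
    \<open>\<beta> x\<close>.\<close>
  have sub: "\<sigma> (a (finsum P (\<lambda>b. f b \<odot>\<^bsub>P\<^esub> e b) B0)) \<in> Idl\<^bsub>R\<^esub> ?A"
    if "finite B0" "B0 \<subseteq> B" "f \<in> B0 \<rightarrow> carrier R" for B0 f
    using that
  proof induction
    case empty
    have "\<sigma> (a \<zero>\<^bsub>P\<^esub>) = \<zero>\<^bsub>R\<^esub>"
      using module_homs_zero[OF a_hom P.module_axioms Q.module_axioms]
        module_homs_zero[OF \<sigma>_hom Q.module_axioms P.R.module_regular] by simp
    then show ?case by simp
  next
    case (insert b F)
    have eb: "e b \<in> carrier P" and ef: "\<And>i. i \<in> F \<Longrightarrow> e i \<in> carrier P" and fb: "f b \<in> carrier R"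
      and ff: "\<And>i. i \<in> F \<Longrightarrow> f i \<in> carrier R" and FB: "F \<subseteq> B" and fF: "f \<in> F \<rightarrow> carrier R"
      using insert.prems B(2) by auto
    let ?s = "finsum P (\<lambda>b. f b \<odot>\<^bsub>P\<^esub> e b) F"
    have sP: "?s \<in> carrier P"
      by (rule P.M.finsum_closed) (use ef ff in blast)
    have sb: "\<sigma> (a (e b)) \<in> Idl\<^bsub>R\<^esub> ?A" using gen insert.prems by blast
    have "finsum P (\<lambda>b. f b \<odot>\<^bsub>P\<^esub> e b) (insert b F) = f b \<odot>\<^bsub>P\<^esub> e b \<oplus>\<^bsub>P\<^esub> ?s"
      by (rule P.M.finsum_insert[OF insert.hyps]) (use ef ff eb fb in blast)+
    then have "\<sigma> (a (finsum P (\<lambda>b. f b \<odot>\<^bsub>P\<^esub> e b) (insert b F))) = \<sigma> (a (f b \<odot>\<^bsub>P\<^esub> e b \<oplus>\<^bsub>P\<^esub> ?s))"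
      by (rule arg_cong)
    also have "\<dots> = f b \<otimes>\<^bsub>R\<^esub> \<sigma> (a (e b)) \<oplus>\<^bsub>R\<^esub> \<sigma> (a ?s)"
      using aD(2)[OF eb] aD(2)[OF sP] eb sP fb
      by (simp only: aD(3)[OF P.smult_closed[OF fb eb] sP] aD(4)[OF fb eb] \<sigma>D(4)[OF fb aD(2)[OF eb]]
          \<sigma>D(3)[OF Q.smult_closed[OF fb aD(2)[OF eb]] aD(2)[OF sP]])
    also have "\<dots> \<in> Idl\<^bsub>R\<^esub> ?A"
      by (rule J.a_closed[OF J.I_l_closed[OF sb fb] insert.IH[OF FB fF]])
    finally show ?case .
  qed
  have "x \<in> Idl\<^bsub>R\<^esub> ?A" if x: "x \<in> I" for x
  proof -
    have "\<sigma> (a (finsum P (\<lambda>b. c b (\<beta> x) \<odot>\<^bsub>P\<^esub> e b) B)) \<in> Idl\<^bsub>R\<^esub> ?A"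
      by (rule sub) (use B cD \<beta>D(2)[OF x] in auto)
    then have "\<sigma> (a (\<beta> x)) \<in> Idl\<^bsub>R\<^esub> ?A"
      unfolding dual[OF \<beta>D(2)[OF x]] .
    then have mem: "\<sigma> (a (\<beta> x)) \<oplus>\<^bsub>R\<^esub> x \<otimes>\<^bsub>R\<^esub> (\<one>\<^bsub>R\<^esub> \<ominus>\<^bsub>R\<^esub> \<sigma> q0) \<in> Idl\<^bsub>R\<^esub> ?A"
      by (rule J.a_closed) (rule J.I_l_closed[OF subsetD[OF gen] I.Icarr[OF x]], simp)
    \<comment> \<open>Multiply the decomposition of 1 into \<open>\<sigma> q0\<close> and its
      complement by x; the first summand becomes \<open>\<sigma> (a (\<beta> x))\<close>.\<close>
    have xeq: "x = \<sigma> (a (\<beta> x)) \<oplus>\<^bsub>R\<^esub> x \<otimes>\<^bsub>R\<^esub> (\<one>\<^bsub>R\<^esub> \<ominus>\<^bsub>R\<^esub> \<sigma> q0)"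
    proof -
      have "x \<otimes>\<^bsub>R\<^esub> (\<sigma> q0 \<oplus>\<^bsub>R\<^esub> (\<one>\<^bsub>R\<^esub> \<ominus>\<^bsub>R\<^esub> \<sigma> q0)) = x" unfolding compl_add by (rule P.R.r_one[OF I.Icarr[OF x]])
      then show ?thesis
        unfolding \<sigma>_a_\<beta>[OF x] P.R.r_distr[OF \<sigma>D(2)[OF q0] I.Icarr[OF compl_mem] I.Icarr[OF x]] by (rule sym)
    qed
    show ?thesis by (subst xeq) (rule mem)
  qed
  then have "I = Idl\<^bsub>R\<^esub> ?A"
    by (intro subset_antisym subsetI subsetD[OF P.R.genideal_minimal[OF ideal_I AI]])
  moreover have "finite ?A" using B(1) by simp
  ultimately show ?thesis
    unfolding finitely_generated_ideal_def by (intro conjI exI[of _ ?A]) (rule ideal_I Ac | assumption)+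
qed

end

section \<open>Invertible ideals\<close>

lemma finsum_regular_module: "finsum (regular_module R) f A = finsum R f A"
  by (simp add: finsum_def finprod_def foldD_def)

text \<open>Every submodule of I is again an ideal of R, so a submodule containing ideal generators
  of I contains all of I.\<close>

lemma finitely_generated_ideal_module:
  assumes "cring R" "finitely_generated_ideal R I"
  shows "finitely_generated_module R (ideal_module R I)"
proof -
  interpret R: cring R by fact
  obtain A where A: "finite A" "A \<subseteq> carrier R" "I = Idl\<^bsub>R\<^esub> A" and I: "ideal I R"
    using assms(2) unfolding finitely_generated_ideal_def by blast
  interpret M: module R "ideal_module R I" by (rule R.module_ideal_module[OF I])
  interpret I: ideal I R by fact
  have "I \<subseteq> N" if N: "submodule N R (ideal_module R I)" "A \<subseteq> N" for N
  proof -
    have sub: "N \<subseteq> I" using M.submoduleE(1)[OF N(1)] by simp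
    have z: "\<zero>\<^bsub>R\<^esub> \<in> N" using subgroup.one_closed[OF submodule.axioms(1)[OF N(1)]] by simp
    have sm: "r \<otimes>\<^bsub>R\<^esub> x \<in> N" if "r \<in> carrier R" "x \<in> N" for r x
      using M.submoduleE(4)[OF N(1) that] by simp
    have "ideal N R"
    proof (rule idealI[OF R.ring_axioms])
      show "subgroup N (add_monoid R)"
      proof
        \<comment> \<open>The additive inverse is the product with -1, so closure under scalars
          covers it.\<close>
        fix x assume "x \<in> N"
        then show "inv\<^bsub>add_monoid R\<^esub> x \<in> N"
          using sm[of "\<ominus>\<^bsub>R\<^esub> \<one>\<^bsub>R\<^esub>" x] sub I.Icarr by (auto simp: R.l_minus simp flip: a_inv_def)
      qed (use sub I.Icarr z M.submoduleE(5)[OF N(1)] in auto)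
      show "r \<otimes>\<^bsub>R\<^esub> x \<in> N" if "x \<in> N" "r \<in> carrier R" for x r by (rule sm[OF that(2,1)])
      then show "x \<otimes>\<^bsub>R\<^esub> r \<in> N" if "x \<in> N" "r \<in> carrier R" for x r
        using that sub I.Icarr R.m_comm by (metis subsetD)
    qed
    then show ?thesis unfolding A(3) using N(2) by (rule R.genideal_minimal)
  qed
  moreover have "A \<subseteq> I" unfolding A(3) by (rule R.genideal_self[OF A(2)])
  ultimately show ?thesis
    using A(1) M.carrier_is_submodule M.module_axioms
    unfolding finitely_generated_module_def module_span_def by (auto intro!: exI[of _ A])
qed

text \<open>Fix a nonzero x in I. By linearity x may be moved in and out of each \<open>c b\<close>,
  so x times the sum of the \<open>c b (e b)\<close> is the expansion of x in the dual basis, that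
  is x itself; cancel x in the domain.\<close>

lemma pruefer_invertible_ideal:
  fixes R :: "('a, 'm) ring_scheme"
  assumes "pruefer_domain R" "finitely_generated_ideal R I" "I \<noteq> {\<zero>\<^bsub>R\<^esub>}"
  shows "\<exists>(B :: 'a set) e c. dual_basis R (ideal_module R I) B e c \<and>
    finsum R (\<lambda>b. c b (e b)) B = \<one>\<^bsub>R\<^esub>"
proof -
  interpret R: domain R using assms(1) by (simp add: pruefer_domain_def)
  have I: "ideal I R" using assms(2) by (simp add: finitely_generated_ideal_def)
  interpret I: ideal I R by fact
  have proj: "projective_module R (ideal_module R I)"
    using assms(1,2) by (simp add: pruefer_domain_def)
  obtain B :: "'a set" and e c where db: "dual_basis R (ideal_module R I) B e c"
    using fg_projective_dual_basis[OF finitely_generated_ideal_module[OF R.is_cring assms(2)] proj] by blast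
  note B = dual_basisD(1,2)[OF db, simplified] and c = dual_basisD(3)[OF db]
  note cD = module_homsD[OF c, simplified]
  note eI = B(2)
  \<comment> \<open>Sums formed in the module with carrier I and in R are different terms. The
    inclusion of I into R, being a homomorphism, carries one to the other.\<close>
  have fr: "finsum (ideal_module R I) f B = finsum R f B" if f: "f \<in> B \<rightarrow> I" for f
  proof -
    have inc: "(\<lambda>x\<in>carrier (ideal_module R I). x) \<in> module_homs R (ideal_module R I) (regular_module R)"
      by (rule module_homsI[OF _ _ _ R.module_ideal_module[OF I]]) (auto simp: I.Icarr)
    interpret M: module R "ideal_module R I" by (rule R.module_ideal_module[OF I])
    let ?s = "finsum (ideal_module R I) f B"
    have "?s \<in> I" using M.M.finsum_closed[of f B] f by simp
    then have "?s = (\<lambda>x\<in>carrier (ideal_module R I). x) ?s" by simp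
    also have "\<dots> = finsum (regular_module R) (\<lambda>b. (\<lambda>x\<in>carrier (ideal_module R I). x) (f b)) B"
      by (rule module_homs_finsum[OF inc R.module_ideal_module[OF I] R.module_regular B(1)])
         (use f in auto)
    also have "\<dots> = finsum R (\<lambda>b. (\<lambda>x\<in>carrier (ideal_module R I). x) (f b)) B"
      by (rule finsum_regular_module)
    also have "\<dots> = finsum R f B"
      by (rule R.finsum_cong') (use f in \<open>auto intro: I.Icarr\<close>)
    finally show ?thesis .
  qed
  have d: "finsum R (\<lambda>b. c b x \<otimes>\<^bsub>R\<^esub> e b) B = x" if x: "x \<in> I" for x
    using dual_basisD(4)[OF db, of x] x fr[of "\<lambda>b. c b x \<otimes>\<^bsub>R\<^esub> e b"] cD(2) eI
    by (simp add: I.I_l_closed)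
  obtain x where x: "x \<in> I" "x \<noteq> \<zero>\<^bsub>R\<^esub>"
    using assms(3) I.zero_closed by blast
  have xc: "x \<in> carrier R" using x I.Icarr by blast
  have sc: "finsum R (\<lambda>b. c b (e b)) B \<in> carrier R" by (rule R.finsum_closed) (use cD eI in auto)
  have "x \<otimes>\<^bsub>R\<^esub> finsum R (\<lambda>b. c b (e b)) B = finsum R (\<lambda>b. x \<otimes>\<^bsub>R\<^esub> c b (e b)) B"
    by (rule R.finsum_rdistr) (use B xc cD eI in auto)
  also have "\<dots> = finsum R (\<lambda>b. c b x \<otimes>\<^bsub>R\<^esub> e b) B"
  proof (rule R.finsum_cong')
    \<comment> \<open>Both sides are the value of \<open>c b\<close> at the product of x and
      \<open>e b\<close>, where either factor may be taken as the scalar.\<close>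
    show "x \<otimes>\<^bsub>R\<^esub> c b (e b) = c b x \<otimes>\<^bsub>R\<^esub> e b" if b: "b \<in> B" for b
      using cD(4)[OF b xc eI[OF b]] cD(4)[OF b I.Icarr[OF eI[OF b]] x(1)] xc x(1) eI[OF b] I.Icarr
        cD(2)[OF b x(1)] by (simp add: R.m_comm)
  qed (use x eI cD I.Icarr in auto)
  also have "\<dots> = x" by (rule d[OF x(1)])
  finally have "x \<otimes>\<^bsub>R\<^esub> finsum R (\<lambda>b. c b (e b)) B = x \<otimes>\<^bsub>R\<^esub> \<one>\<^bsub>R\<^esub>" using xc by simp
  then have "finsum R (\<lambda>b. c b (e b)) B = \<one>\<^bsub>R\<^esub>"
    using R.m_lcancel[OF x(2) xc sc] by simp
  then show ?thesis using db by blast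
qed

section \<open>Rings inverting a presentation\<close>

text \<open>Neither commutativity of \<open>S\<close> nor centrality of the image of
  \<open>l\<close> is assumed, since the universal property ranges over all rings.\<close>

locale split_presentation_ring = split_presentation R P Q a I q0 \<sigma> \<tau> \<beta> + S: ring S
  for R :: "('a, 'm) ring_scheme" and P :: "('a, 'c) module" and Q :: "('a, 'd) module"
    and a I q0 \<sigma> \<tau> \<beta> and S :: "('s, 'n) ring_scheme" +
  fixes l :: "'a \<Rightarrow> 's"
  assumes l_hom: "l \<in> ring_hom R S"
begin

abbreviation "N \<equiv> restrict_scalars S l"

sublocale N: module R N by (rule module_restrict_scalars[OF P.R.is_cring S.ring_axioms l_hom])
sublocale PN: module_pair R P N by unfold_locales
sublocale QN: module_pair R Q N by unfold_locales

lemmas l_closed [simp] = ring_hom_closed [OF l_hom]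
  and l_add = ring_hom_add [OF l_hom]
  and l_mult = ring_hom_mult [OF l_hom]
  and l_one = ring_hom_one [OF l_hom]

lemma l_zero: "l \<zero>\<^bsub>R\<^esub> = \<zero>\<^bsub>S\<^esub>"
  using ring_hom_zero[OF l_hom P.R.ring_axioms S.ring_axioms] .

lemma l_finsum: "finite A \<Longrightarrow> f \<in> A \<rightarrow> carrier R \<Longrightarrow> l (finsum R f A) = finsum S (\<lambda>i. l (f i)) A"
proof (induction A rule: finite_induct)
  case (insert i A)
  have "l (finsum R f (insert i A)) = l (f i \<oplus>\<^bsub>R\<^esub> finsum R f A)"
    using insert by (subst P.R.finsum_insert) auto
  also have "\<dots> = l (f i) \<oplus>\<^bsub>S\<^esub> finsum S (\<lambda>i. l (f i)) A"
    using insert by (subst l_add) (auto intro!: P.R.finsum_closed)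
  also have "\<dots> = finsum S (\<lambda>i. l (f i)) (insert i A)"
    using insert by (subst S.finsum_insert) (auto simp: Pi_iff)
  finally show ?case .
qed (simp add: l_zero)

lemma additive_group_S: "comm_group (add_monoid S)"
  by (rule S.a_comm_group)

text \<open>A functional on M induces a map from M tensor S to S. Such maps are the means of reading
  information about S off equations between tensors.\<close>

lemma functional_tensor:
  assumes M: "module R M" and h: "h \<in> module_homs R M (regular_module R)"
  obtains k where "k \<in> hom (tensor_product R M N) (add_monoid S)"
    "\<And>x s. x \<in> carrier M \<Longrightarrow> s \<in> carrier S \<Longrightarrow> k (pure_tensor R M N x s) = l (h x) \<otimes>\<^bsub>S\<^esub> s"
proof -
  interpret module_pair R M N using M N.module_axioms by (simp add: module_pair_def)
  note hD = module_homsD[OF h, simplified]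
  obtain k where "k \<in> hom T (add_monoid S)"
    "\<And>x s. x \<in> carrier M \<Longrightarrow> s \<in> carrier N \<Longrightarrow> k (pure x s) = l (h x) \<otimes>\<^bsub>S\<^esub> s"
  proof (rule tensor_universal[OF additive_group_S, of "\<lambda>x s. l (h x) \<otimes>\<^bsub>S\<^esub> s"])
    show "l (h (r \<odot>\<^bsub>M\<^esub> x)) \<otimes>\<^bsub>S\<^esub> s = l (h x) \<otimes>\<^bsub>S\<^esub> (r \<odot>\<^bsub>N\<^esub> s)"
      if "r \<in> carrier R" "x \<in> carrier M" "s \<in> carrier N" for r x s
    proof -
      \<comment> \<open>The factors are exchanged inside R, which is commutative, so that
        \<open>l r\<close> ends up next to s; nothing is commuted in S.\<close>
      have "l (h (r \<odot>\<^bsub>M\<^esub> x)) = l (h x \<otimes>\<^bsub>R\<^esub> r)" using that hD by (simp add: P.R.m_comm)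
      then show ?thesis using that hD by (simp add: l_mult S.m_assoc)
    qed
  qed (auto simp: hD l_add S.l_distr S.r_distr)
  then show thesis using that by simp
qed

abbreviation "\<alpha>S \<equiv> tensor_map R a Q N"

lemmas \<alpha>S_hom = tensor_map_hom [OF P.module_axioms Q.module_axioms N.module_axioms a_hom]
  and \<alpha>S_pure = tensor_map_pure [OF P.module_axioms Q.module_axioms N.module_axioms a_hom]

text \<open>Only surjectivity of \<open>\<alpha>S\<close> matters. The functional induced by
  \<open>\<sigma>\<close> sends the image of \<open>\<alpha>S\<close> into \<open>D\<close>, because
  \<open>\<sigma>\<close> takes \<open>a\<close> of P into I; so its value
  \<open>l (\<sigma> q0)\<close> at the tensor of \<open>q0\<close> and 1 lies in \<open>D\<close>.
  The complement of \<open>\<sigma> q0\<close> lies in I, hence its image lies in \<open>D\<close>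
  as well.\<close>

lemma one_mem_extended_ideal:
  assumes iso: "\<alpha>S \<in> iso PN.T QN.T"
    and D: "subgroup D (add_monoid S)" "\<And>x s. x \<in> I \<Longrightarrow> s \<in> carrier S \<Longrightarrow> l x \<otimes>\<^bsub>S\<^esub> s \<in> D"
  shows "\<one>\<^bsub>S\<^esub> \<in> D"
proof -
  interpret D: subgroup D "add_monoid S" by fact
  interpret AS: group "add_monoid S" using additive_group_S by (simp add: comm_group_def)
  obtain k where k: "k \<in> hom QN.T (add_monoid S)"
    "\<And>q s. q \<in> carrier Q \<Longrightarrow> s \<in> carrier S \<Longrightarrow> k (QN.pure q s) = l (\<sigma> q) \<otimes>\<^bsub>S\<^esub> s"
    using functional_tensor[OF Q.module_axioms \<sigma>_hom] by metis
  interpret k: group_hom QN.T "add_monoid S" k by unfold_locales (rule k)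
  interpret al: group_hom PN.T QN.T \<alpha>S by unfold_locales (rule \<alpha>S_hom)
  have "k (\<alpha>S t) \<in> D" if "t \<in> carrier PN.T" for t
    using that
  proof (induction rule: PN.tensor_induct)
    case (pure x y)
    then show ?case using aD(2) by (simp add: \<alpha>S_pure k(2) D(2) \<sigma>_a_mem)
  next
    case (div s t)
    have "k (\<alpha>S (s \<otimes>\<^bsub>PN.T\<^esub> inv\<^bsub>PN.T\<^esub> t)) = k (\<alpha>S s) \<otimes>\<^bsub>add_monoid S\<^esub> inv\<^bsub>add_monoid S\<^esub> k (\<alpha>S t)"
      using div(1,2) by (simp only: al.hom_mult al.hom_inv k.hom_mult k.hom_inv al.hom_closed
          PN.T.inv_closed QN.T.inv_closed)
    then show ?case using D.m_closed[OF div(3) D.m_inv_closed[OF div(4)]] by (simp only:)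
  qed
  moreover obtain t where "t \<in> carrier PN.T" "\<alpha>S t = QN.pure q0 \<one>\<^bsub>S\<^esub>"
  proof -
    have "QN.pure q0 \<one>\<^bsub>S\<^esub> \<in> \<alpha>S ` carrier PN.T"
      using iso unfolding iso_def bij_betw_def by simp
    then show thesis using that by fastforce
  qed
  ultimately have "k (QN.pure q0 \<one>\<^bsub>S\<^esub>) \<in> D" by metis
  then have 1: "l (\<sigma> q0) \<in> D" using \<sigma>D(2)[OF q0] by (simp add: k(2))
  have c: "\<one>\<^bsub>R\<^esub> \<ominus>\<^bsub>R\<^esub> \<sigma> q0 \<in> carrier R" using compl_mem by (rule I.Icarr)
  have 2: "l (\<one>\<^bsub>R\<^esub> \<ominus>\<^bsub>R\<^esub> \<sigma> q0) \<in> D"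
    using D(2)[OF compl_mem S.one_closed] c by simp
  have "l (\<sigma> q0 \<oplus>\<^bsub>R\<^esub> (\<one>\<^bsub>R\<^esub> \<ominus>\<^bsub>R\<^esub> \<sigma> q0)) \<in> D"
    using D.m_closed[OF 1 2] l_add[OF \<sigma>D(2)[OF q0] c] by simp
  then show ?thesis unfolding compl_add l_one .
qed

end

text \<open>For nonzero \<open>I\<close> in a domain the extra equation follows from the other properties of a dual basis;
  it says that \<open>I\<close> is invertible.\<close>

locale invertible_presentation_ring = split_presentation_ring R P Q a I q0 \<sigma> \<tau> \<beta> S l
  for R :: "('a, 'm) ring_scheme" and P :: "('a, 'c) module" and Q :: "('a, 'd) module"
    and a I q0 \<sigma> \<tau> \<beta> and S :: "('s, 'n) ring_scheme" and l +
  fixes B :: "'i set" and e :: "'i \<Rightarrow> 'a" and c :: "'i \<Rightarrow> 'a \<Rightarrow> 'a"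
  assumes dual: "dual_basis R (ideal_module R I) B e c"
    and partition: "finsum R (\<lambda>b. c b (e b)) B = \<one>\<^bsub>R\<^esub>"
begin

lemmas finite_B [simp] = dual_basisD(1) [OF dual]
  and e_mem = dual_basisD(2) [OF dual, simplified]
  and cD = module_homsD [OF dual_basisD(3) [OF dual], simplified]
  and expansion = dual_basisD(4) [OF dual]

sublocale MI: module R "ideal_module R I" by (rule P.R.module_ideal_module[OF ideal_I])

text \<open>Only injectivity of \<open>\<alpha>S\<close> matters. It kills the tensors of
  \<open>\<beta> x\<close> with s; functionals on P then show that s is annihilated by every
  \<open>l (c b x)\<close> with x in I, in particular by the \<open>l (c b (e b))\<close>, whose sum
  is 1.\<close>

lemma ideal_faithful:
  assumes iso: "\<alpha>S \<in> iso PN.T QN.T"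
    and s: "s \<in> carrier S" "\<And>x. x \<in> I \<Longrightarrow> l x \<otimes>\<^bsub>S\<^esub> s = \<zero>\<^bsub>S\<^esub>"
  shows "s = \<zero>\<^bsub>S\<^esub>"
proof -
  interpret AS: group "add_monoid S" using additive_group_S by (simp add: comm_group_def)
  interpret al: group_hom PN.T QN.T \<alpha>S by unfold_locales (rule \<alpha>S_hom)
  have inj: "inj_on \<alpha>S (carrier PN.T)" using iso by (simp add: iso_def bij_betw_def)
  \<comment> \<open>Under \<open>\<alpha>S\<close> the tensor becomes that of x times
    \<open>q0\<close> with s; moving x across leaves \<open>l x\<close> times s, which is
    zero.\<close>
  have pz: "PN.pure (\<beta> x) s = \<one>\<^bsub>PN.T\<^esub>" if x: "x \<in> I" for x
  proof (rule inj_onD[OF inj])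
    have "\<alpha>S (PN.pure (\<beta> x) s) = QN.pure (x \<odot>\<^bsub>Q\<^esub> q0) s"
      using \<beta>D(2)[OF x] s(1) by (simp add: \<alpha>S_pure a_\<beta>[OF x])
    also have "\<dots> = QN.pure q0 \<zero>\<^bsub>S\<^esub>"
      using QN.pure_balanced[OF I.Icarr[OF x] q0, of s] s x by simp
    also have "\<dots> = \<one>\<^bsub>QN.T\<^esub>" using QN.pure_zero_right[OF q0] by simp
    finally show "\<alpha>S (PN.pure (\<beta> x) s) = \<alpha>S \<one>\<^bsub>PN.T\<^esub>" by (simp only: al.hom_one)
    show "PN.pure (\<beta> x) s \<in> carrier PN.T" using \<beta>D(2)[OF x] s(1) by simp
  qed simp
  have sq: "\<sigma> q0 \<in> carrier R" using \<sigma>D(2)[OF q0] .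
  have ce: "l (c b x) \<otimes>\<^bsub>S\<^esub> s = \<zero>\<^bsub>S\<^esub>" if b: "b \<in> B" and x: "x \<in> I" for b x
  proof -
    \<comment> \<open>The composite is defined on P because \<open>\<sigma>\<close> maps the image
      of \<open>a\<close> into I, the domain of \<open>c b\<close>.\<close>
    have h: "(\<lambda>y\<in>carrier P. c b (\<sigma> (a y))) \<in> module_homs R P (regular_module R)"
      by (rule module_homsI[OF _ _ _ P.module_axioms])
        (use b \<sigma>_a_mem aD \<sigma>D cD in simp_all)
    obtain k where k: "k \<in> hom PN.T (add_monoid S)"
      "\<And>y s. y \<in> carrier P \<Longrightarrow> s \<in> carrier S \<Longrightarrow>
        k (PN.pure y s) = l ((\<lambda>y\<in>carrier P. c b (\<sigma> (a y))) y) \<otimes>\<^bsub>S\<^esub> s"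
      using functional_tensor[OF P.module_axioms h] by metis
    have cx: "c b x \<in> carrier R" using cD(2)[OF b x] .
    have "c b (\<sigma> (a (\<beta> x))) = \<sigma> q0 \<otimes>\<^bsub>R\<^esub> c b x"
      unfolding \<sigma>_a_\<beta>[OF x] using cD(4)[OF b sq x] P.R.m_comm[OF I.Icarr[OF x] sq] by simp
    then have "l (\<sigma> q0 \<otimes>\<^bsub>R\<^esub> c b x) \<otimes>\<^bsub>S\<^esub> s = k (PN.pure (\<beta> x) s)"
      using k(2)[OF \<beta>D(2)[OF x] s(1)] \<beta>D(2)[OF x] by simp
    also have "\<dots> = \<zero>\<^bsub>S\<^esub>"
      unfolding pz[OF x] using hom_one[OF k(1) PN.T.is_group S.a_group] by simp
    finally have 1: "l (\<sigma> q0 \<otimes>\<^bsub>R\<^esub> c b x) \<otimes>\<^bsub>S\<^esub> s = \<zero>\<^bsub>S\<^esub>" .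
    \<comment> \<open>The functional detects only the multiple by \<open>\<sigma> q0\<close>. The
      complementary multiple of \<open>c b x\<close> lies in I, so it annihilates s by
      assumption.\<close>
    let ?e = "\<one>\<^bsub>R\<^esub> \<ominus>\<^bsub>R\<^esub> \<sigma> q0"
    have e: "?e \<in> carrier R" using compl_mem by (rule I.Icarr)
    have "?e \<otimes>\<^bsub>R\<^esub> c b x \<in> I" by (rule I.I_r_closed[OF compl_mem cx])
    then have 2: "l (?e \<otimes>\<^bsub>R\<^esub> c b x) \<otimes>\<^bsub>S\<^esub> s = \<zero>\<^bsub>S\<^esub>" by (rule s(2))
    have "c b x = (\<sigma> q0 \<oplus>\<^bsub>R\<^esub> ?e) \<otimes>\<^bsub>R\<^esub> c b x" unfolding compl_add using cx by simp
    also have "\<dots> = \<sigma> q0 \<otimes>\<^bsub>R\<^esub> c b x \<oplus>\<^bsub>R\<^esub> ?e \<otimes>\<^bsub>R\<^esub> c b x" by (rule P.R.l_distr[OF sq e cx])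
    finally have 3: "c b x = \<sigma> q0 \<otimes>\<^bsub>R\<^esub> c b x \<oplus>\<^bsub>R\<^esub> ?e \<otimes>\<^bsub>R\<^esub> c b x" .
    have "l (c b x) \<otimes>\<^bsub>S\<^esub> s = (l (\<sigma> q0 \<otimes>\<^bsub>R\<^esub> c b x) \<oplus>\<^bsub>S\<^esub> l (?e \<otimes>\<^bsub>R\<^esub> c b x)) \<otimes>\<^bsub>S\<^esub> s"
      using arg_cong[OF 3, of l] l_add[OF P.R.m_closed[OF sq cx] P.R.m_closed[OF e cx]] by (simp only:)
    also have "\<dots> = l (\<sigma> q0 \<otimes>\<^bsub>R\<^esub> c b x) \<otimes>\<^bsub>S\<^esub> s \<oplus>\<^bsub>S\<^esub> l (?e \<otimes>\<^bsub>R\<^esub> c b x) \<otimes>\<^bsub>S\<^esub> s"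
      by (rule S.l_distr) (use sq e cx s(1) in auto)
    finally show ?thesis unfolding 1 2 by simp
  qed
  have "s = l (finsum R (\<lambda>b. c b (e b)) B) \<otimes>\<^bsub>S\<^esub> s" unfolding partition l_one using s(1) by simp
  also have "\<dots> = finsum S (\<lambda>b. l (c b (e b))) B \<otimes>\<^bsub>S\<^esub> s"
    by (subst l_finsum) (use finite_B e_mem cD(2) in auto)
  also have "\<dots> = finsum S (\<lambda>b. l (c b (e b)) \<otimes>\<^bsub>S\<^esub> s) B"
    by (rule S.finsum_ldistr) (use finite_B e_mem cD(2) s(1) in auto)
  also have "\<dots> = finsum S (\<lambda>b. \<zero>\<^bsub>S\<^esub>) B"
    by (rule S.finsum_cong') (use ce e_mem in auto)
  also have "\<dots> = \<zero>\<^bsub>S\<^esub>" by (rule S.finsum_zero)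
  finally show ?thesis .
qed

end

section \<open>Homomorphisms from the ideal to the ring\<close>

lemma finsum_restrict_scalars: "finsum (restrict_scalars S h) f A = finsum S f A"
  by (simp add: finsum_def finprod_def foldD_def)

context invertible_presentation_ring
begin

lemma extend_functional:
  assumes iso: "\<alpha>S \<in> iso PN.T QN.T" and b: "b \<in> B"
  obtains u where "u \<in> carrier S" "\<And>x. x \<in> I \<Longrightarrow> l (c b x) = l x \<otimes>\<^bsub>S\<^esub> u"
proof -
  define D where "D = {t \<in> carrier S. \<exists>u\<in>carrier S. \<forall>x\<in>I. l (c b x) \<otimes>\<^bsub>S\<^esub> t = l x \<otimes>\<^bsub>S\<^esub> u}"
  have cc: "l (c b x) \<in> carrier S" "l x \<in> carrier S" if "x \<in> I" for x
    using that cD(2)[OF b] I.Icarr by auto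
  have "subgroup D (add_monoid S)"
  proof
    show "D \<subseteq> carrier (add_monoid S)" by (auto simp: D_def)
    show "\<one>\<^bsub>add_monoid S\<^esub> \<in> D" by (auto simp: D_def cc intro!: bexI[of _ "\<zero>\<^bsub>S\<^esub>"])
    fix t assume "t \<in> D"
    then obtain u where u: "t \<in> carrier S" "u \<in> carrier S" "\<And>x. x \<in> I \<Longrightarrow> l (c b x) \<otimes>\<^bsub>S\<^esub> t = l x \<otimes>\<^bsub>S\<^esub> u"
      by (auto simp: D_def)
    have "\<ominus>\<^bsub>S\<^esub> t \<in> D"
      unfolding D_def using u by (auto simp: cc S.r_minus intro!: bexI[of _ "\<ominus>\<^bsub>S\<^esub> u"])
    then show "inv\<^bsub>add_monoid S\<^esub> t \<in> D" by (simp flip: a_inv_def)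
    fix t' assume "t' \<in> D"
    then obtain u' where u': "t' \<in> carrier S" "u' \<in> carrier S" "\<And>x. x \<in> I \<Longrightarrow> l (c b x) \<otimes>\<^bsub>S\<^esub> t' = l x \<otimes>\<^bsub>S\<^esub> u'"
      by (auto simp: D_def)
    show "t \<otimes>\<^bsub>add_monoid S\<^esub> t' \<in> D"
      unfolding D_def using u u' by (auto simp: cc S.r_distr intro!: bexI[of _ "u \<oplus>\<^bsub>S\<^esub> u'"])
  qed
  moreover have "l y \<otimes>\<^bsub>S\<^esub> s \<in> D" if y: "y \<in> I" and s: "s \<in> carrier S" for y s
  proof -
    have "l (c b x) \<otimes>\<^bsub>S\<^esub> (l y \<otimes>\<^bsub>S\<^esub> s) = l x \<otimes>\<^bsub>S\<^esub> (l (c b y) \<otimes>\<^bsub>S\<^esub> s)" if x: "x \<in> I" for x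
    proof -
      \<comment> \<open>Both products are the value of \<open>c b\<close> at the product of x and
        y.\<close>
      have "c b x \<otimes>\<^bsub>R\<^esub> y = x \<otimes>\<^bsub>R\<^esub> c b y"
        using cD(4)[OF b I.Icarr[OF x] y] cD(4)[OF b I.Icarr[OF y] x]
          P.R.m_comm[OF I.Icarr[OF x] I.Icarr[OF y]] P.R.m_comm[OF cD(2)[OF b x] I.Icarr[OF y]] by simp
      then have "l (c b x) \<otimes>\<^bsub>S\<^esub> l y = l x \<otimes>\<^bsub>S\<^esub> l (c b y)"
        using l_mult[OF cD(2)[OF b x] I.Icarr[OF y]] l_mult[OF I.Icarr[OF x] cD(2)[OF b y]] by simp
      then show ?thesis using cc x y s by (metis S.m_assoc)
    qed
    then show ?thesis unfolding D_def using cc y s by (auto intro!: bexI[of _ "l (c b y) \<otimes>\<^bsub>S\<^esub> s"])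
  qed
  ultimately have "\<one>\<^bsub>S\<^esub> \<in> D" by (rule one_mem_extended_ideal[OF iso])
  then show thesis using that cc by (auto simp: D_def)
qed

text \<open>Apply f to the expansion of x in the dual basis and replace each coefficient
  \<open>l (c b x)\<close> by \<open>l x\<close> times \<open>u b\<close>; then \<open>l x\<close>
  factors out on the left.\<close>

lemma extend_hom:
  assumes iso: "\<alpha>S \<in> iso PN.T QN.T" and f: "f \<in> module_homs R (ideal_module R I) N"
  shows "\<exists>s\<in>carrier S. \<forall>x\<in>I. f x = l x \<otimes>\<^bsub>S\<^esub> s"
proof -
  have "\<forall>b\<in>B. \<exists>u. u \<in> carrier S \<and> (\<forall>x\<in>I. l (c b x) = l x \<otimes>\<^bsub>S\<^esub> u)"
    using extend_functional[OF iso] by metis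
  then obtain u where u: "\<And>b. b \<in> B \<Longrightarrow> u b \<in> carrier S"
    "\<And>b x. b \<in> B \<Longrightarrow> x \<in> I \<Longrightarrow> l (c b x) = l x \<otimes>\<^bsub>S\<^esub> u b" by metis
  note fD = module_homsD[OF f, simplified]
  let ?s = "finsum S (\<lambda>b. u b \<otimes>\<^bsub>S\<^esub> f (e b)) B"
  have "f x = l x \<otimes>\<^bsub>S\<^esub> ?s" if x: "x \<in> I" for x
  proof -
    have "f (finsum (ideal_module R I) (\<lambda>b. c b x \<odot>\<^bsub>ideal_module R I\<^esub> e b) B) =
        finsum S (\<lambda>b. f (c b x \<odot>\<^bsub>ideal_module R I\<^esub> e b)) B"
      unfolding finsum_restrict_scalars[of S l, symmetric]
      by (rule module_homs_finsum[OF f MI.module_axioms N.module_axioms finite_B])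
         (use cD(2) e_mem x I.I_l_closed in auto)
    also have "\<dots> = finsum S (\<lambda>b. l x \<otimes>\<^bsub>S\<^esub> (u b \<otimes>\<^bsub>S\<^esub> f (e b))) B"
    proof (rule S.finsum_cong')
      show "f (c b x \<odot>\<^bsub>ideal_module R I\<^esub> e b) = l x \<otimes>\<^bsub>S\<^esub> (u b \<otimes>\<^bsub>S\<^esub> f (e b))" if b: "b \<in> B" for b
        using fD(4)[OF cD(2)[OF b x] e_mem[OF b]] u(1)[OF b] u(2)[OF b x] fD(2)[OF e_mem[OF b]] x I.Icarr
        by (simp add: S.m_assoc)
    qed (use u fD e_mem x I.Icarr in auto)
    also have "\<dots> = l x \<otimes>\<^bsub>S\<^esub> ?s"
      by (rule S.finsum_rdistr[symmetric]) (use u fD e_mem x I.Icarr in auto)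
    finally show ?thesis using expansion[of x] x by simp
  qed
  moreover have "?s \<in> carrier S" by (rule S.finsum_closed) (use u fD e_mem in auto)
  ultimately show ?thesis by blast
qed

text \<open>Sending s to the sum of the tensors of \<open>e b\<close> with \<open>u b\<close> times
  s inverts the multiplication map from I tensor S to S. Transported along the splitting of the
  presentation, this gives an explicit inverse of \<open>\<alpha>S\<close>.\<close>

lemma iso_if_functionals_extend:
  assumes u: "\<And>b. b \<in> B \<Longrightarrow> u b \<in> carrier S"
      "\<And>b x. b \<in> B \<Longrightarrow> x \<in> I \<Longrightarrow> l (c b x) = l x \<otimes>\<^bsub>S\<^esub> u b"
    and central: "\<And>r s. r \<in> carrier R \<Longrightarrow> s \<in> carrier S \<Longrightarrow> l r \<otimes>\<^bsub>S\<^esub> s = s \<otimes>\<^bsub>S\<^esub> l r"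
  shows "\<alpha>S \<in> iso PN.T QN.T"
proof -
  \<comment> \<open>The part of q along \<open>q0\<close> is lifted to I tensor S and sent to P by
    \<open>\<beta>\<close>; the part \<open>\<tau> q\<close> already lies in P and is added in
    \<open>?G\<close>.\<close>
  let ?F = "\<lambda>q s b. PN.pure (\<beta> (e b)) (u b \<otimes>\<^bsub>S\<^esub> (l (\<sigma> q) \<otimes>\<^bsub>S\<^esub> s))"
  let ?G = "\<lambda>q s. finprod PN.T (?F q s) B \<otimes>\<^bsub>PN.T\<^esub> PN.pure (\<tau> q) s"
  have be: "\<beta> (e b) \<in> carrier P" if "b \<in> B" for b using \<beta>D(2) e_mem that by blast
  have Fc: "?F q s b \<in> carrier PN.T" if "b \<in> B" "q \<in> carrier Q" "s \<in> carrier S" for q s b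
    using that be u(1) \<sigma>D(2) by simp
  have Fc': "?F q s \<in> B \<rightarrow> carrier PN.T" if "q \<in> carrier Q" "s \<in> carrier S" for q s
    using Fc that by blast
  have pc: "finprod PN.T (?F q s) B \<in> carrier PN.T" if "q \<in> carrier Q" "s \<in> carrier S" for q s
    by (rule PN.T.finprod_closed[OF Fc'[OF that]])
  have swap: "x \<otimes>\<^bsub>PN.T\<^esub> y \<otimes>\<^bsub>PN.T\<^esub> (x' \<otimes>\<^bsub>PN.T\<^esub> y') = x \<otimes>\<^bsub>PN.T\<^esub> x' \<otimes>\<^bsub>PN.T\<^esub> (y \<otimes>\<^bsub>PN.T\<^esub> y')"
    if "x \<in> carrier PN.T" "y \<in> carrier PN.T" "x' \<in> carrier PN.T" "y' \<in> carrier PN.T" for x y x' y'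
    using that by (simp add: PN.T.m_ac)
  obtain g where g: "g \<in> hom QN.T PN.T"
    "\<And>q s. q \<in> carrier Q \<Longrightarrow> s \<in> carrier N \<Longrightarrow> g (QN.pure q s) = ?G q s"
  proof (rule QN.tensor_universal[OF PN.T.comm_group_axioms, of ?G])
    show "?G q s \<in> carrier PN.T" if "q \<in> carrier Q" "s \<in> carrier N" for q s
      using that pc \<tau>D(2) by simp
    show "?G (q \<oplus>\<^bsub>Q\<^esub> q') s = ?G q s \<otimes>\<^bsub>PN.T\<^esub> ?G q' s"
      if q: "q \<in> carrier Q" "q' \<in> carrier Q" and "s \<in> carrier N" for q q' s
    proof -
      have s: "s \<in> carrier S" using that by simp
      have "finprod PN.T (?F (q \<oplus>\<^bsub>Q\<^esub> q') s) B = finprod PN.T (\<lambda>b. ?F q s b \<otimes>\<^bsub>PN.T\<^esub> ?F q' s b) B"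
      proof (rule PN.T.finprod_cong')
        fix b assume b: "b \<in> B"
        have "u b \<otimes>\<^bsub>S\<^esub> (l (\<sigma> (q \<oplus>\<^bsub>Q\<^esub> q')) \<otimes>\<^bsub>S\<^esub> s) =
          u b \<otimes>\<^bsub>S\<^esub> (l (\<sigma> q) \<otimes>\<^bsub>S\<^esub> s) \<oplus>\<^bsub>S\<^esub> u b \<otimes>\<^bsub>S\<^esub> (l (\<sigma> q') \<otimes>\<^bsub>S\<^esub> s)"
          using q s u(1)[OF b] \<sigma>D(2,3) by (simp add: l_add S.l_distr S.r_distr)
        then show "?F (q \<oplus>\<^bsub>Q\<^esub> q') s b = ?F q s b \<otimes>\<^bsub>PN.T\<^esub> ?F q' s b"
          using PN.pure_add_right[OF be[OF b], of "u b \<otimes>\<^bsub>S\<^esub> (l (\<sigma> q) \<otimes>\<^bsub>S\<^esub> s)" "u b \<otimes>\<^bsub>S\<^esub> (l (\<sigma> q') \<otimes>\<^bsub>S\<^esub> s)"]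
            q s u(1)[OF b] \<sigma>D(2) by simp
      qed (use Fc q s in auto)
      also have "\<dots> = finprod PN.T (?F q s) B \<otimes>\<^bsub>PN.T\<^esub> finprod PN.T (?F q' s) B"
        by (rule PN.T.finprod_multf) (use Fc q s in auto)
      finally show ?thesis
        using swap pc q s \<tau>D(2,3) by (simp add: PN.pure_add_left)
    qed
    show "?G q (s \<oplus>\<^bsub>N\<^esub> s') = ?G q s \<otimes>\<^bsub>PN.T\<^esub> ?G q s'"
      if q: "q \<in> carrier Q" and "s \<in> carrier N" "s' \<in> carrier N" for q s s'
    proof -
      have s: "s \<in> carrier S" "s' \<in> carrier S" using that by simp_all
      have "finprod PN.T (?F q (s \<oplus>\<^bsub>S\<^esub> s')) B = finprod PN.T (\<lambda>b. ?F q s b \<otimes>\<^bsub>PN.T\<^esub> ?F q s' b) B"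
      proof (rule PN.T.finprod_cong')
        fix b assume b: "b \<in> B"
        have "u b \<otimes>\<^bsub>S\<^esub> (l (\<sigma> q) \<otimes>\<^bsub>S\<^esub> (s \<oplus>\<^bsub>S\<^esub> s')) =
          u b \<otimes>\<^bsub>S\<^esub> (l (\<sigma> q) \<otimes>\<^bsub>S\<^esub> s) \<oplus>\<^bsub>S\<^esub> u b \<otimes>\<^bsub>S\<^esub> (l (\<sigma> q) \<otimes>\<^bsub>S\<^esub> s')"
          using q s u(1)[OF b] \<sigma>D(2,3) by (simp add: S.r_distr)
        then show "?F q (s \<oplus>\<^bsub>S\<^esub> s') b = ?F q s b \<otimes>\<^bsub>PN.T\<^esub> ?F q s' b"
          using PN.pure_add_right[OF be[OF b], of "u b \<otimes>\<^bsub>S\<^esub> (l (\<sigma> q) \<otimes>\<^bsub>S\<^esub> s)" "u b \<otimes>\<^bsub>S\<^esub> (l (\<sigma> q) \<otimes>\<^bsub>S\<^esub> s')"]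
            q s u(1)[OF b] \<sigma>D(2) by simp
      qed (use Fc q s in auto)
      also have "\<dots> = finprod PN.T (?F q s) B \<otimes>\<^bsub>PN.T\<^esub> finprod PN.T (?F q s') B"
        by (rule PN.T.finprod_multf) (use Fc q s in auto)
      finally show ?thesis
        using swap pc q s \<tau>D(2,3) PN.pure_add_right by simp
    qed
    show "?G (r \<odot>\<^bsub>Q\<^esub> q) s = ?G q (r \<odot>\<^bsub>N\<^esub> s)"
      if r: "r \<in> carrier R" and q: "q \<in> carrier Q" and "s \<in> carrier N" for r q s
    proof -
      have s: "s \<in> carrier S" using that by simp
      have "l (\<sigma> (r \<odot>\<^bsub>Q\<^esub> q)) = l (\<sigma> q) \<otimes>\<^bsub>S\<^esub> l r"
        using \<sigma>D(2)[OF q] \<sigma>D(4)[OF r q] l_mult[OF _ r] P.R.m_comm[OF r] by simp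
      then have "l (\<sigma> (r \<odot>\<^bsub>Q\<^esub> q)) \<otimes>\<^bsub>S\<^esub> s = l (\<sigma> q) \<otimes>\<^bsub>S\<^esub> (l r \<otimes>\<^bsub>S\<^esub> s)"
        using \<sigma>D(2)[OF q] r s by (simp add: S.m_assoc)
      moreover have "PN.pure (\<tau> (r \<odot>\<^bsub>Q\<^esub> q)) s = PN.pure (\<tau> q) (r \<odot>\<^bsub>N\<^esub> s)"
        using \<tau>D(4)[OF r q] PN.pure_balanced[OF r \<tau>D(2)[OF q], of s] s by simp
      ultimately show ?thesis by simp
    qed
  qed blast
  interpret g: group_hom QN.T PN.T g by unfold_locales (rule g(1))
  interpret al: group_hom PN.T QN.T \<alpha>S by unfold_locales (rule \<alpha>S_hom)
  have left: "g (\<alpha>S t) = t" if "t \<in> carrier PN.T" for t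
  proof -
    have "(g \<circ> \<alpha>S) t = id t"
    proof (rule PN.tensor_hom_eq[OF PN.T.is_group _ _ _ that])
      show "g \<circ> \<alpha>S \<in> hom PN.T PN.T" by (rule hom_compose[OF \<alpha>S_hom g(1)])
      show "id \<in> hom PN.T PN.T" by (simp add: hom_def)
      fix y s assume y: "y \<in> carrier P" and "s \<in> carrier N"
      then have s: "s \<in> carrier S" by simp
      let ?y = "\<sigma> (a y)"
      have yI: "?y \<in> I" by (rule \<sigma>_a_mem[OF y])
      have yR: "?y \<in> carrier R" using yI by (rule I.Icarr)
      have cb: "c b ?y \<odot>\<^bsub>P\<^esub> \<beta> (e b) \<in> carrier P" if "b \<in> B" for b
        using be[OF that] cD(2)[OF that yI] by simp
      have "finprod PN.T (?F (a y) s) B = finprod PN.T (\<lambda>b. PN.pure (c b ?y \<odot>\<^bsub>P\<^esub> \<beta> (e b)) s) B"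
      proof (rule PN.T.finprod_cong')
        fix b assume b: "b \<in> B"
        have "u b \<otimes>\<^bsub>S\<^esub> (l ?y \<otimes>\<^bsub>S\<^esub> s) = (u b \<otimes>\<^bsub>S\<^esub> l ?y) \<otimes>\<^bsub>S\<^esub> s"
          using u(1)[OF b] yR s by (simp add: S.m_assoc)
        \<comment> \<open>Centrality enters here: \<open>u b\<close> multiplies elements of I from
          the right, whereas the inverse produces it on the left.\<close>
        also have "\<dots> = l (c b ?y) \<otimes>\<^bsub>S\<^esub> s"
          using central[OF yR u(1)[OF b]] u(2)[OF b yI] by simp
        finally show "?F (a y) s b = PN.pure (c b ?y \<odot>\<^bsub>P\<^esub> \<beta> (e b)) s"
          using PN.pure_balanced[OF cD(2)[OF b yI] be[OF b], of s] s by simp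
      qed (use cb s in auto)
      also have "\<dots> = PN.pure (finsum P (\<lambda>b. c b ?y \<odot>\<^bsub>P\<^esub> \<beta> (e b)) B) s"
        by (rule PN.pure_finsum_left[symmetric]) (use cb s in auto)
      also have "finsum P (\<lambda>b. c b ?y \<odot>\<^bsub>P\<^esub> \<beta> (e b)) B =
          finsum P (\<lambda>b. \<beta> (c b ?y \<odot>\<^bsub>ideal_module R I\<^esub> e b)) B"
        by (rule P.M.finsum_cong') (use cb \<beta>D(4) cD(2) yI e_mem in auto)
      also have "\<dots> = \<beta> (finsum (ideal_module R I) (\<lambda>b. c b ?y \<odot>\<^bsub>ideal_module R I\<^esub> e b) B)"
        by (rule module_homs_finsum[OF \<beta>_hom MI.module_axioms P.module_axioms finite_B, symmetric])
           (use cD(2) e_mem yI I.I_l_closed in auto)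
      also have "\<dots> = \<beta> ?y" using expansion[of ?y] yI by simp
      finally have "g (\<alpha>S (PN.pure y s)) = PN.pure (\<beta> ?y) s \<otimes>\<^bsub>PN.T\<^esub> PN.pure (\<tau> (a y)) s"
        using y s aD(2)[OF y] by (simp add: \<alpha>S_pure g(2))
      also have "\<dots> = PN.pure (\<beta> ?y \<oplus>\<^bsub>P\<^esub> \<tau> (a y)) s"
        by (rule PN.pure_add_left[symmetric]) (use \<beta>D(2)[OF yI] \<tau>D(2) aD(2)[OF y] s in auto)
      finally show "(g \<circ> \<alpha>S) (PN.pure y s) = id (PN.pure y s)" by (simp add: split_P[OF y])
    qed
    then show ?thesis by simp
  qed
  have right: "\<alpha>S (g t) = t" if "t \<in> carrier QN.T" for t
  proof -
    have "(\<alpha>S \<circ> g) t = id t"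
    proof (rule QN.tensor_hom_eq[OF QN.T.is_group _ _ _ that])
      show "\<alpha>S \<circ> g \<in> hom QN.T QN.T" by (rule hom_compose[OF g(1) \<alpha>S_hom])
      show "id \<in> hom QN.T QN.T" by (simp add: hom_def)
      fix q s assume q: "q \<in> carrier Q" and "s \<in> carrier N"
      then have s: "s \<in> carrier S" by simp
      have sq: "\<sigma> q \<in> carrier R" by (rule \<sigma>D(2)[OF q])
      let ?z = "l (\<sigma> q) \<otimes>\<^bsub>S\<^esub> s"
      have z: "?z \<in> carrier S" using sq s by simp
      have fin: "\<alpha>S (finprod PN.T f B') = finprod QN.T (\<lambda>b. \<alpha>S (f b)) B'"
        if "finite B'" "f \<in> B' \<rightarrow> carrier PN.T" for f and B' :: "'i set"
        using that
      proof induction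
        case empty
        show ?case using al.hom_one by simp
      next
        case (insert b B')
        have f: "f b \<in> carrier PN.T" "f \<in> B' \<rightarrow> carrier PN.T" using insert.prems by auto
        have f': "(\<lambda>b. \<alpha>S (f b)) \<in> B' \<rightarrow> carrier QN.T" using f(2) al.hom_closed by blast
        show ?case
          unfolding PN.T.finprod_insert[OF insert.hyps f(2,1)]
            QN.T.finprod_insert[OF insert.hyps f' al.hom_closed[OF f(1)]]
            al.hom_mult[OF f(1) PN.T.finprod_closed[OF f(2)]] insert.IH[OF f(2)] ..
      qed
      have eR: "e b \<in> carrier R" if "b \<in> B" for b using e_mem[OF that] by (rule I.Icarr)
      have leu: "l (e b) \<otimes>\<^bsub>S\<^esub> (u b \<otimes>\<^bsub>S\<^esub> ?z) = l (c b (e b)) \<otimes>\<^bsub>S\<^esub> ?z" if b: "b \<in> B" for b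
        using eR[OF b] u(1)[OF b] z u(2)[OF b e_mem[OF b]] by (simp only: S.m_assoc l_closed)
      have lc: "l (c b (e b)) \<in> carrier S" if "b \<in> B" for b using cD(2)[OF that e_mem[OF that]] by simp
      have "\<alpha>S (finprod PN.T (?F q s) B) = finprod QN.T (\<lambda>b. \<alpha>S (?F q s b)) B"
        by (rule fin[OF finite_B Fc'[OF q s]])
      also have "\<dots> = finprod QN.T (\<lambda>b. QN.pure q0 (l (c b (e b)) \<otimes>\<^bsub>S\<^esub> ?z)) B"
      proof (rule QN.T.finprod_cong')
        fix b assume b: "b \<in> B"
        have uz: "u b \<otimes>\<^bsub>S\<^esub> ?z \<in> carrier S" using u(1)[OF b] z by simp
        have "\<alpha>S (?F q s b) = QN.pure (e b \<odot>\<^bsub>Q\<^esub> q0) (u b \<otimes>\<^bsub>S\<^esub> ?z)"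
          using \<alpha>S_pure[OF be[OF b], of "u b \<otimes>\<^bsub>S\<^esub> ?z"] uz a_\<beta>[OF e_mem[OF b]] by simp
        also have "\<dots> = QN.pure q0 (l (e b) \<otimes>\<^bsub>S\<^esub> (u b \<otimes>\<^bsub>S\<^esub> ?z))"
          using QN.pure_balanced[OF eR[OF b] q0, of "u b \<otimes>\<^bsub>S\<^esub> ?z"] uz by simp
        finally show "\<alpha>S (?F q s b) = QN.pure q0 (l (c b (e b)) \<otimes>\<^bsub>S\<^esub> ?z)" unfolding leu[OF b] .
      qed (use lc z in auto)
      also have "\<dots> = QN.pure q0 (finsum N (\<lambda>b. l (c b (e b)) \<otimes>\<^bsub>S\<^esub> ?z) B)"
        by (rule QN.pure_finsum_right[symmetric]) (use lc z in auto)
      also have "finsum N (\<lambda>b. l (c b (e b)) \<otimes>\<^bsub>S\<^esub> ?z) B = finsum S (\<lambda>b. l (c b (e b))) B \<otimes>\<^bsub>S\<^esub> ?z"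
        unfolding finsum_restrict_scalars
        by (rule S.finsum_ldistr[symmetric]) (use lc z in auto)
      \<comment> \<open>Invertibility of I gives surjectivity: the sum of the
        \<open>c b (e b)\<close> is 1.\<close>
      also have "finsum S (\<lambda>b. l (c b (e b))) B = \<one>\<^bsub>S\<^esub>"
        using l_finsum[OF finite_B, of "\<lambda>b. c b (e b)"] cD(2) e_mem partition l_one by auto
      also have "QN.pure q0 (\<one>\<^bsub>S\<^esub> \<otimes>\<^bsub>S\<^esub> ?z) = QN.pure (\<sigma> q \<odot>\<^bsub>Q\<^esub> q0) s"
        using QN.pure_balanced[OF sq q0, of s] s z by simp
      finally have "\<alpha>S (g (QN.pure q s)) = QN.pure (\<sigma> q \<odot>\<^bsub>Q\<^esub> q0) s \<otimes>\<^bsub>QN.T\<^esub> QN.pure (a (\<tau> q)) s"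
        using q s pc[OF q s] \<tau>D(2)[OF q] by (simp add: \<alpha>S_pure g(2) al.hom_mult)
      also have "\<dots> = QN.pure (\<sigma> q \<odot>\<^bsub>Q\<^esub> q0 \<oplus>\<^bsub>Q\<^esub> a (\<tau> q)) s"
        by (rule QN.pure_add_left[symmetric]) (use sq aD(2) \<tau>D(2)[OF q] s in auto)
      finally show "(\<alpha>S \<circ> g) (QN.pure q s) = id (QN.pure q s)" by (simp add: split[OF q])
    qed
    then show ?thesis by simp
  qed
  have "bij_betw \<alpha>S (carrier PN.T) (carrier QN.T)"
    by (rule bij_betw_byWitness[of _ g]) (use left right al.hom_closed g.hom_closed in auto)
  then show ?thesis using \<alpha>S_hom by (simp add: iso_def)
qed

end

section \<open>Closed modules\<close>

lemma scalar_hom: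
  assumes "module R M" "x \<in> carrier M" "ideal I R"
  shows "(\<lambda>r\<in>carrier (ideal_module R I). r \<odot>\<^bsub>M\<^esub> x) \<in> module_homs R (ideal_module R I) M"
proof -
  interpret M: module R M by fact
  interpret I: ideal I R by fact
  show ?thesis
    by (rule module_homsI[OF _ _ _ M.R.module_ideal_module[OF assms(3)]])
       (use assms(2) in \<open>auto simp: I.Icarr M.smult_l_distr M.smult_assoc1\<close>)
qed

lemma regular_module_hom_apply:
  assumes "cring R" "f \<in> module_homs R (regular_module R) M" "x \<in> carrier R"
  shows "f x = x \<odot>\<^bsub>M\<^esub> f \<one>\<^bsub>R\<^esub>"
proof -
  interpret R: cring R by fact
  show ?thesis using module_homsD(4)[OF assms(2), of x "\<one>\<^bsub>R\<^esub>"] assms(3) by simp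
qed

lemma closed_moduleD:
  assumes "closed_module R G M" "I \<in> G" "f \<in> module_homs R (ideal_module R I) M"
    and "ideal I R"
  shows "\<exists>c\<in>carrier M. \<forall>x\<in>I. f x = x \<odot>\<^bsub>M\<^esub> c"
proof -
  interpret M: module R M using assms(1) by (simp add: closed_module_def)
  interpret I: ideal I R by fact
  obtain h where h: "h \<in> module_homs R (regular_module R) M" "f = restrict h I"
  proof -
    have "bij_betw (\<lambda>f. restrict f I) (module_homs R (regular_module R) M) (module_homs R (ideal_module R I) M)"
      using assms(1,2) by (simp add: closed_module_def)
    then have "f \<in> (\<lambda>f. restrict f I) ` module_homs R (regular_module R) M"
      using assms(3) by (simp add: bij_betw_def)
    then show thesis using that by (elim imageE)
  qed
  have "f x = x \<odot>\<^bsub>M\<^esub> h \<one>\<^bsub>R\<^esub>" if "x \<in> I" for x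
    using regular_module_hom_apply[OF M.R.is_cring h(1) I.Icarr[OF that]] that h(2) by simp
  moreover have "h \<one>\<^bsub>R\<^esub> \<in> carrier M" using module_homsD(2)[OF h(1)] by simp
  ultimately show ?thesis by blast
qed

text \<open>For J in the topology choose I in the basis inside J. Faithfulness makes elements of M
  determined by their multiples by I, which gives injectivity; an element representing f on I then
  represents f on all of J.\<close>

lemma closed_module_if_basis:
  assumes "module R M" and top: "gabriel_topology R G" and basis: "basis_of_topology B G"
    and ext: "\<And>I f. I \<in> B \<Longrightarrow> f \<in> module_homs R (ideal_module R I) M \<Longrightarrow>
      \<exists>c\<in>carrier M. \<forall>x\<in>I. f x = x \<odot>\<^bsub>M\<^esub> c"
    and faithful: "\<And>I c. I \<in> B \<Longrightarrow> c \<in> carrier M \<Longrightarrow> (\<And>x. x \<in> I \<Longrightarrow> x \<odot>\<^bsub>M\<^esub> c = \<zero>\<^bsub>M\<^esub>) \<Longrightarrow> c = \<zero>\<^bsub>M\<^esub>"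
  shows "closed_module R G M"
proof -
  interpret M: module R M by fact
  have "bij_betw (\<lambda>f. restrict f J) (module_homs R (regular_module R) M) (module_homs R (ideal_module R J) M)"
    if J: "J \<in> G" for J
  proof -
    have ideals: "\<And>J. J \<in> G \<Longrightarrow> ideal J R" using top unfolding gabriel_topology_def by blast
    then have idJ: "ideal J R" using J .
    interpret J: ideal J R by fact
    obtain I where I: "I \<in> B" "I \<subseteq> J" "ideal I R"
      using basis ideals J unfolding basis_of_topology_def by (meson subsetD)
    interpret I: ideal I R by fact
    have eqI: "c = d" if cd: "c \<in> carrier M" "d \<in> carrier M" "\<And>x. x \<in> I \<Longrightarrow> x \<odot>\<^bsub>M\<^esub> c = x \<odot>\<^bsub>M\<^esub> d" for c d
    proof -
      have "c \<oplus>\<^bsub>M\<^esub> \<ominus>\<^bsub>M\<^esub> d = \<zero>\<^bsub>M\<^esub>"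
      proof (rule faithful[OF I(1)])
        fix x assume x: "x \<in> I"
        have "x \<odot>\<^bsub>M\<^esub> (c \<oplus>\<^bsub>M\<^esub> \<ominus>\<^bsub>M\<^esub> d) = x \<odot>\<^bsub>M\<^esub> c \<oplus>\<^bsub>M\<^esub> \<ominus>\<^bsub>M\<^esub> (x \<odot>\<^bsub>M\<^esub> d)"
          using cd(1,2) I.Icarr[OF x] by (simp add: M.smult_r_distr M.smult_r_minus)
        then show "x \<odot>\<^bsub>M\<^esub> (c \<oplus>\<^bsub>M\<^esub> \<ominus>\<^bsub>M\<^esub> d) = \<zero>\<^bsub>M\<^esub>"
          using cd(2) I.Icarr[OF x] unfolding cd(3)[OF x] by (simp add: M.M.r_neg)
      qed (use cd in auto)
      then show ?thesis using cd(1,2) M.M.minus_equality[of c "\<ominus>\<^bsub>M\<^esub> d"] by simp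
    qed
    show ?thesis
    proof (rule bij_betwI')
      fix f f' assume f: "f \<in> module_homs R (regular_module R) M" and f': "f' \<in> module_homs R (regular_module R) M"
      note ap = regular_module_hom_apply[OF M.R.is_cring f] regular_module_hom_apply[OF M.R.is_cring f']
      have one: "f \<one>\<^bsub>R\<^esub> \<in> carrier M" "f' \<one>\<^bsub>R\<^esub> \<in> carrier M"
        using module_homsD(2)[OF f] module_homsD(2)[OF f'] by simp_all
      show "restrict f J = restrict f' J \<longleftrightarrow> f = f'"
      proof
        assume r: "restrict f J = restrict f' J"
        have "f \<one>\<^bsub>R\<^esub> = f' \<one>\<^bsub>R\<^esub>"
        proof (rule eqI[OF one])
          fix x assume x: "x \<in> I"
          have "f x = f' x" using fun_cong[OF r, of x] subsetD[OF I(2) x] by simp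
          then show "x \<odot>\<^bsub>M\<^esub> f \<one>\<^bsub>R\<^esub> = x \<odot>\<^bsub>M\<^esub> f' \<one>\<^bsub>R\<^esub>"
            unfolding ap(1)[OF I.Icarr[OF x], symmetric] ap(2)[OF I.Icarr[OF x], symmetric] .
        qed
        show "f = f'"
        proof (rule extensionalityI)
          show "f \<in> extensional (carrier R)" "f' \<in> extensional (carrier R)"
            using module_homsD(1)[OF f] module_homsD(1)[OF f'] by simp_all
          show "f x = f' x" if "x \<in> carrier R" for x
            unfolding ap(1)[OF that] ap(2)[OF that] \<open>f \<one>\<^bsub>R\<^esub> = f' \<one>\<^bsub>R\<^esub>\<close> ..
        qed
      qed simp
    next
      fix f assume f: "f \<in> module_homs R (regular_module R) M"
      have "restrict f (carrier (ideal_module R J)) \<in> module_homs R (ideal_module R J) M"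
        by (rule module_homsI[OF _ _ _ M.R.module_ideal_module[OF idJ]])
           (use module_homsD[OF f] J.Icarr in simp_all)
      then show "restrict f J \<in> module_homs R (ideal_module R J) M" by simp
    next
      fix f assume f: "f \<in> module_homs R (ideal_module R J) M"
      note fD = module_homsD[OF f, simplified]
      have "restrict f (carrier (ideal_module R I)) \<in> module_homs R (ideal_module R I) M"
        by (rule module_homsI[OF _ _ _ M.R.module_ideal_module[OF I(3)]])
           (use fD subsetD[OF I(2)] in simp_all)
      from ext[OF I(1) this] obtain c where c: "c \<in> carrier M"
        "\<forall>x\<in>I. restrict f (carrier (ideal_module R I)) x = x \<odot>\<^bsub>M\<^esub> c" by blast
      have fx: "f x = x \<odot>\<^bsub>M\<^esub> c" if "x \<in> I" for x using bspec[OF c(2) that] that by simp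
      \<comment> \<open>Test against x in I: since the product of x and y lies in I, x times
        \<open>f y\<close> is already known.\<close>
      have fy: "f y = y \<odot>\<^bsub>M\<^esub> c" if y: "y \<in> J" for y
      proof (rule eqI)
        fix x assume x: "x \<in> I"
        have xy: "x \<otimes>\<^bsub>R\<^esub> y \<in> I" using I.I_r_closed[OF x J.Icarr[OF y]] .
        show "x \<odot>\<^bsub>M\<^esub> f y = x \<odot>\<^bsub>M\<^esub> (y \<odot>\<^bsub>M\<^esub> c)"
          using fD(4)[OF I.Icarr[OF x] y] fx[OF xy] M.smult_assoc1[OF I.Icarr[OF x] J.Icarr[OF y] c(1)]
          by simp
      qed (use fD(2)[OF y] c(1) J.Icarr[OF y] in auto)
      let ?h = "\<lambda>r\<in>carrier (regular_module R). r \<odot>\<^bsub>M\<^esub> c"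
      have "f = restrict ?h J"
        by (rule extensionalityI[of _ J]) (use fD(1) fy J.Icarr in auto)
      then show "\<exists>h\<in>module_homs R (regular_module R) M. f = restrict h J"
        using scalar_hom[OF M.module_axioms c(1) M.R.oneideal] by blast
    qed
  qed
  then show ?thesis using assms(1) by (simp add: closed_module_def)
qed

text \<open>Both maps are factorizations of the same homomorphism from R to C, namely r to
  \<open>g (l r)\<close>.\<close>

lemma gabriel_localization_unique:
  fixes C :: "('a, 't) module"
  assumes "cring R" and loc: "gabriel_localization TYPE('t) R G Q l" and C: "closed_module R G C"
    and g: "g \<in> module_homs R (restrict_scalars Q l) C" and g': "g' \<in> module_homs R (restrict_scalars Q l) C"
    and eq: "\<And>r. r \<in> carrier R \<Longrightarrow> g (l r) = g' (l r)"
  shows "g = g'"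
proof -
  interpret R: cring R by fact
  have l: "l \<in> ring_hom R Q" and ring: "ring Q" using loc by (auto simp: gabriel_localization_def)
  interpret N: module R "restrict_scalars Q l" by (rule module_restrict_scalars[OF R.is_cring ring l])
  note gD = module_homsD[OF g, simplified]
  have f: "(\<lambda>r\<in>carrier (regular_module R). g (l r)) \<in> module_homs R (regular_module R) C"
    by (rule module_homsI[OF _ _ _ R.module_regular])
       (use gD ring_hom_closed[OF l] ring_hom_add[OF l] ring_hom_mult[OF l] in simp_all)
  have "\<exists>!k. k \<in> module_homs R (restrict_scalars Q l) C \<and>
      (\<forall>r\<in>carrier R. k (l r) = (\<lambda>r\<in>carrier (regular_module R). g (l r)) r)"
    using loc C f unfolding gabriel_localization_def by blast
  moreover have "\<forall>r\<in>carrier R. g (l r) = (\<lambda>r\<in>carrier (regular_module R). g (l r)) r"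
    and "\<forall>r\<in>carrier R. g' (l r) = (\<lambda>r\<in>carrier (regular_module R). g (l r)) r"
    using eq by simp_all
  ultimately show ?thesis using g g' by blast
qed

text \<open>Left and right multiplication by \<open>l r\<close> are R-linear endomorphisms of Q, the
  former because R is commutative, the latter by associativity. They agree on the image of R and Q
  is closed, so they are equal.\<close>

lemma gabriel_localization_central:
  fixes Q :: "('q, 'k) ring_scheme"
  assumes "cring R" and loc: "gabriel_localization TYPE('q) R G Q l"
    and r: "r \<in> carrier R" and s: "s \<in> carrier Q"
  shows "l r \<otimes>\<^bsub>Q\<^esub> s = s \<otimes>\<^bsub>Q\<^esub> l r"
proof -
  interpret R: cring R by fact
  have l: "l \<in> ring_hom R Q" and ring: "ring Q" and cl: "closed_module R G (restrict_scalars Q l)"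
    using loc by (auto simp: gabriel_localization_def)
  interpret Q: ring Q by fact
  interpret N: module R "restrict_scalars Q l" by (rule module_restrict_scalars[OF R.is_cring ring l])
  note lc = ring_hom_closed[OF l]
  have comm: "l x \<otimes>\<^bsub>Q\<^esub> l y = l y \<otimes>\<^bsub>Q\<^esub> l x" if "x \<in> carrier R" "y \<in> carrier R" for x y
    using ring_hom_mult[OF l] that R.m_comm by metis
  have 1: "(\<lambda>s\<in>carrier (restrict_scalars Q l). l r \<otimes>\<^bsub>Q\<^esub> s) \<in>
      module_homs R (restrict_scalars Q l) (restrict_scalars Q l)"
  proof (rule module_homsI[OF _ _ _ N.module_axioms])
    fix x s assume x: "x \<in> carrier R" and "s \<in> carrier (restrict_scalars Q l)"
    then show "l r \<otimes>\<^bsub>Q\<^esub> (x \<odot>\<^bsub>restrict_scalars Q l\<^esub> s) = x \<odot>\<^bsub>restrict_scalars Q l\<^esub> (l r \<otimes>\<^bsub>Q\<^esub> s)"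
      using lc[OF r] lc[OF x] comm[OF r x] Q.m_assoc[of "l r" "l x" s] Q.m_assoc[of "l x" "l r" s] by simp
  qed (use lc r in \<open>auto simp: Q.r_distr\<close>)
  have 2: "(\<lambda>s\<in>carrier (restrict_scalars Q l). s \<otimes>\<^bsub>Q\<^esub> l r) \<in>
      module_homs R (restrict_scalars Q l) (restrict_scalars Q l)"
    by (rule module_homsI[OF _ _ _ N.module_axioms]) (use lc r Q.l_distr Q.m_assoc in auto)
  have "(\<lambda>s\<in>carrier (restrict_scalars Q l). l r \<otimes>\<^bsub>Q\<^esub> s) = (\<lambda>s\<in>carrier (restrict_scalars Q l). s \<otimes>\<^bsub>Q\<^esub> l r)"
  proof (rule gabriel_localization_unique[OF assms(1) loc cl 1 2])
    fix x assume x: "x \<in> carrier R"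
    show "(\<lambda>s\<in>carrier (restrict_scalars Q l). l r \<otimes>\<^bsub>Q\<^esub> s) (l x) = (\<lambda>s\<in>carrier (restrict_scalars Q l). s \<otimes>\<^bsub>Q\<^esub> l r) (l x)"
      using comm[OF r x] lc[OF x] by simp
  qed
  from fun_cong[OF this, of s] show ?thesis using s by simp
qed

section \<open>Cyclic modules and annihilators\<close>

lemma cyclic_span:
  assumes "module R M" and x: "x \<in> carrier M" and "module_span R M {x} = carrier M" and "y \<in> carrier M"
  shows "\<exists>r\<in>carrier R. y = r \<odot>\<^bsub>M\<^esub> x"
proof -
  interpret M: module R M by fact
  have "submodule {y \<in> carrier M. \<exists>r\<in>carrier R. y = r \<odot>\<^bsub>M\<^esub> x} R M"
  proof (rule M.submoduleI)
    show "\<zero>\<^bsub>M\<^esub> \<in> {y \<in> carrier M. \<exists>r\<in>carrier R. y = r \<odot>\<^bsub>M\<^esub> x}"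
      using x by (auto intro!: bexI[of _ "\<zero>\<^bsub>R\<^esub>"])
    show "\<ominus>\<^bsub>M\<^esub> a \<in> {y \<in> carrier M. \<exists>r\<in>carrier R. y = r \<odot>\<^bsub>M\<^esub> x}"
      if "a \<in> {y \<in> carrier M. \<exists>r\<in>carrier R. y = r \<odot>\<^bsub>M\<^esub> x}" for a
      using that x by (auto simp flip: M.smult_l_minus)
    show "a \<oplus>\<^bsub>M\<^esub> b \<in> {y \<in> carrier M. \<exists>r\<in>carrier R. y = r \<odot>\<^bsub>M\<^esub> x}"
      if "a \<in> {y \<in> carrier M. \<exists>r\<in>carrier R. y = r \<odot>\<^bsub>M\<^esub> x}" "b \<in> {y \<in> carrier M. \<exists>r\<in>carrier R. y = r \<odot>\<^bsub>M\<^esub> x}" for a b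
      using that x by (auto simp flip: M.smult_l_distr)
    show "a \<odot>\<^bsub>M\<^esub> b \<in> {y \<in> carrier M. \<exists>r\<in>carrier R. y = r \<odot>\<^bsub>M\<^esub> x}"
      if "a \<in> carrier R" "b \<in> {y \<in> carrier M. \<exists>r\<in>carrier R. y = r \<odot>\<^bsub>M\<^esub> x}" for a b
      using that x by (auto simp flip: M.smult_assoc1)
  qed auto
  then show ?thesis
    by (rule module_span_induct[of y R M "{x}", rotated])
       (use assms in \<open>auto intro!: bexI[of _ "\<one>\<^bsub>R\<^esub>"]\<close>)
qed

section \<open>Quotients by annihilators of generators\<close>

lemma quotient_module_simps:
  "carrier (quotient_module R I) = (\<lambda>r. I +>\<^bsub>R\<^esub> r) ` carrier R"
  "\<zero>\<^bsub>quotient_module R I\<^esub> = I"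
  by (auto simp: quotient_module_def FactRing_def A_RCOSETS_def' image_iff)

lemma quotient_module_ops:
  assumes "ideal I R" "x \<in> carrier R" "y \<in> carrier R"
  shows "(I +>\<^bsub>R\<^esub> x) \<oplus>\<^bsub>quotient_module R I\<^esub> (I +>\<^bsub>R\<^esub> y) = I +>\<^bsub>R\<^esub> (x \<oplus>\<^bsub>R\<^esub> y)"
    and "x \<odot>\<^bsub>quotient_module R I\<^esub> (I +>\<^bsub>R\<^esub> y) = I +>\<^bsub>R\<^esub> (x \<otimes>\<^bsub>R\<^esub> y)"
proof -
  interpret I: ideal I R by fact
  have h: "(\<lambda>r. I +>\<^bsub>R\<^esub> r) \<in> ring_hom R (R Quot I)" by (rule I.rcos_ring_hom)
  show "(I +>\<^bsub>R\<^esub> x) \<oplus>\<^bsub>quotient_module R I\<^esub> (I +>\<^bsub>R\<^esub> y) = I +>\<^bsub>R\<^esub> (x \<oplus>\<^bsub>R\<^esub> y)"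
    "x \<odot>\<^bsub>quotient_module R I\<^esub> (I +>\<^bsub>R\<^esub> y) = I +>\<^bsub>R\<^esub> (x \<otimes>\<^bsub>R\<^esub> y)"
    using ring_hom_add[OF h assms(2,3)] ring_hom_mult[OF h assms(2,3)] by (simp_all add: quotient_module_def)
qed

text \<open>The generator is the image of the coset of 1; injectivity of the isomorphism makes its
  annihilator exactly I.\<close>

lemma isomorphic_quotient_generator:
  assumes "cring R" "module R M" "ideal I R" and iso: "module_isomorphic R (quotient_module R I) M"
  obtains m where "m \<in> carrier M" "\<And>x. x \<in> carrier M \<Longrightarrow> \<exists>r\<in>carrier R. x = r \<odot>\<^bsub>M\<^esub> m"
    "module.annihilator R M m = I"
proof -
  interpret R: cring R by fact
  interpret M: module R M by fact
  interpret I: ideal I R by fact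
  obtain f where f: "f \<in> module_homs R (quotient_module R I) M"
    and bij: "bij_betw f (carrier (quotient_module R I)) (carrier M)"
    using iso unfolding module_isomorphic_def by blast
  note fD = module_homsD[OF f]
  have qc: "I +>\<^bsub>R\<^esub> r \<in> carrier (quotient_module R I)" if "r \<in> carrier R" for r
    using that by (auto simp: quotient_module_simps)
  let ?m = "f (I +>\<^bsub>R\<^esub> \<one>\<^bsub>R\<^esub>)"
  have mc: "?m \<in> carrier M" by (rule fD(2)[OF qc]) simp
  have fr: "f (I +>\<^bsub>R\<^esub> r) = r \<odot>\<^bsub>M\<^esub> ?m" if r: "r \<in> carrier R" for r
    using fD(4)[OF r qc[OF R.one_closed]]
    unfolding quotient_module_ops(2)[OF assms(3) r R.one_closed] R.r_one[OF r] .
  have I0: "I +>\<^bsub>R\<^esub> r = I +>\<^bsub>R\<^esub> \<zero>\<^bsub>R\<^esub> \<longleftrightarrow> r \<in> I" if "r \<in> carrier R" for r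
    using R.quotient_eq_iff_same_a_r_cos[OF assms(3) that R.zero_closed]
    unfolding R.minus_eq R.minus_zero R.r_zero[OF that] by (rule sym)
  have gen: "\<exists>r\<in>carrier R. x = r \<odot>\<^bsub>M\<^esub> ?m" if x: "x \<in> carrier M" for x
  proof -
    have "x \<in> f ` carrier (quotient_module R I)" using bij x by (simp add: bij_betw_def)
    then obtain r where r: "r \<in> carrier R" "x = f (I +>\<^bsub>R\<^esub> r)" unfolding quotient_module_simps by blast
    show ?thesis by (rule bexI[OF _ r(1)], rule trans[OF r(2) fr[OF r(1)]])
  qed
  have "r \<odot>\<^bsub>M\<^esub> ?m = \<zero>\<^bsub>M\<^esub> \<longleftrightarrow> r \<in> I" if r: "r \<in> carrier R" for r
  proof -
    have "r \<odot>\<^bsub>M\<^esub> ?m = \<zero>\<^bsub>M\<^esub> \<longleftrightarrow> f (I +>\<^bsub>R\<^esub> r) = f (I +>\<^bsub>R\<^esub> \<zero>\<^bsub>R\<^esub>)"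
      unfolding fr[OF r] fr[OF R.zero_closed] M.smult_l_null[OF mc] ..
    also have "\<dots> \<longleftrightarrow> I +>\<^bsub>R\<^esub> r = I +>\<^bsub>R\<^esub> \<zero>\<^bsub>R\<^esub>"
      using inj_on_eq_iff[OF bij_betw_imp_inj_on[OF bij] qc[OF r] qc[OF R.zero_closed]] .
    finally show ?thesis unfolding I0[OF r] .
  qed
  then have "module.annihilator R M ?m = I"
    using I.Icarr by (auto simp: M.annihilator_def)
  from that[OF mc gen this] show thesis .
qed

lemma generator_quotient_isomorphic:
  assumes "cring R" "module R M" and m: "m \<in> carrier M"
    and gen: "\<And>x. x \<in> carrier M \<Longrightarrow> \<exists>r\<in>carrier R. x = r \<odot>\<^bsub>M\<^esub> m"
  shows "module_isomorphic R (quotient_module R (module.annihilator R M m)) M"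
proof -
  interpret R: cring R by fact
  interpret M: module R M by fact
  let ?I = "M.annihilator m"
  have I: "ideal ?I R" by (rule M.ideal_annihilator[OF m])
  \<comment> \<open>The isomorphism is defined through chosen representatives; \<open>eq\<close>
    shows both that the choice does not matter and that the map is injective.\<close>
  define rep where "rep C = (SOME r. r \<in> carrier R \<and> C = ?I +>\<^bsub>R\<^esub> r)" for C
  define f where "f = (\<lambda>C\<in>carrier (quotient_module R ?I). rep C \<odot>\<^bsub>M\<^esub> m)"
  have eq: "r \<odot>\<^bsub>M\<^esub> m = s \<odot>\<^bsub>M\<^esub> m \<longleftrightarrow> ?I +>\<^bsub>R\<^esub> r = ?I +>\<^bsub>R\<^esub> s" if rs: "r \<in> carrier R" "s \<in> carrier R" for r s
  proof -
    have "?I +>\<^bsub>R\<^esub> r = ?I +>\<^bsub>R\<^esub> s \<longleftrightarrow> r \<oplus>\<^bsub>R\<^esub> \<ominus>\<^bsub>R\<^esub> s \<in> ?I"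
      using R.quotient_eq_iff_same_a_r_cos[OF I rs] unfolding R.minus_eq by blast
    also have "\<dots> \<longleftrightarrow> r \<odot>\<^bsub>M\<^esub> m \<oplus>\<^bsub>M\<^esub> \<ominus>\<^bsub>M\<^esub> (s \<odot>\<^bsub>M\<^esub> m) = \<zero>\<^bsub>M\<^esub>"
      using rs m by (simp add: M.annihilator_def M.smult_l_distr M.smult_l_minus)
    also have "\<dots> \<longleftrightarrow> r \<odot>\<^bsub>M\<^esub> m = s \<odot>\<^bsub>M\<^esub> m"
      using rs m M.M.r_neg M.M.minus_equality[of "r \<odot>\<^bsub>M\<^esub> m" "\<ominus>\<^bsub>M\<^esub> (s \<odot>\<^bsub>M\<^esub> m)"] by auto
    finally show ?thesis by blast
  qed
  have fr: "f (?I +>\<^bsub>R\<^esub> r) = r \<odot>\<^bsub>M\<^esub> m" if r: "r \<in> carrier R" for r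
  proof -
    let ?s = "rep (?I +>\<^bsub>R\<^esub> r)"
    have s: "?s \<in> carrier R \<and> ?I +>\<^bsub>R\<^esub> r = ?I +>\<^bsub>R\<^esub> ?s"
      unfolding rep_def by (rule someI[of _ r]) (simp add: r)
    have "?I +>\<^bsub>R\<^esub> r \<in> carrier (quotient_module R ?I)" using r by (auto simp: quotient_module_simps)
    then have "f (?I +>\<^bsub>R\<^esub> r) = ?s \<odot>\<^bsub>M\<^esub> m" unfolding f_def by (rule restrict_apply')
    also have "\<dots> = r \<odot>\<^bsub>M\<^esub> m" by (rule iffD2[OF eq[OF r conjunct1[OF s]] conjunct2[OF s], symmetric])
    finally show ?thesis .
  qed
  have "f \<in> module_homs R (quotient_module R ?I) M"
    unfolding module_homs_def
  proof (intro CollectI conjI ballI)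
    show "f \<in> extensional (carrier (quotient_module R ?I))" by (simp add: f_def)
    show "f \<in> carrier (quotient_module R ?I) \<rightarrow> carrier M"
      using fr m by (auto simp: quotient_module_simps)
    show "f (C \<oplus>\<^bsub>quotient_module R ?I\<^esub> D) = f C \<oplus>\<^bsub>M\<^esub> f D"
      if "C \<in> carrier (quotient_module R ?I)" "D \<in> carrier (quotient_module R ?I)" for C D
      using that m by (auto simp: quotient_module_simps quotient_module_ops[OF I] fr M.smult_l_distr)
    show "f (r \<odot>\<^bsub>quotient_module R ?I\<^esub> C) = r \<odot>\<^bsub>M\<^esub> f C"
      if "r \<in> carrier R" "C \<in> carrier (quotient_module R ?I)" for r C
      using that m by (auto simp: quotient_module_simps quotient_module_ops[OF I] fr M.smult_assoc1)
  qed
  moreover have "bij_betw f (carrier (quotient_module R ?I)) (carrier M)"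
    unfolding bij_betw_def
  proof
    show "inj_on f (carrier (quotient_module R ?I))"
      by (rule inj_onI) (auto simp: quotient_module_simps fr eq)
    show "f ` carrier (quotient_module R ?I) = carrier M"
    proof
      show "carrier M \<subseteq> f ` carrier (quotient_module R ?I)"
      proof
        fix x assume "x \<in> carrier M"
        then obtain r where "r \<in> carrier R" "x = r \<odot>\<^bsub>M\<^esub> m" using gen by blast
        then show "x \<in> f ` carrier (quotient_module R ?I)" using fr by (auto simp: quotient_module_simps image_iff)
      qed
    qed (use fr m in \<open>auto simp: quotient_module_simps\<close>)
  qed
  ultimately show ?thesis unfolding module_isomorphic_def by blast
qed

text \<open>If only 0 annihilates the generator, multiplying it by scalars is an isomorphism from R
  to M.\<close>

lemma annihilator_ne_zero:
  assumes "module R M" and m: "m \<in> carrier M"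
    and gen: "\<And>x. x \<in> carrier M \<Longrightarrow> \<exists>r\<in>carrier R. x = r \<odot>\<^bsub>M\<^esub> m"
    and "\<not> module_isomorphic R (regular_module R) M"
  shows "module.annihilator R M m \<noteq> {\<zero>\<^bsub>R\<^esub>}"
proof
  interpret M: module R M by fact
  assume ann: "M.annihilator m = {\<zero>\<^bsub>R\<^esub>}"
  let ?f = "\<lambda>r\<in>carrier (regular_module R). r \<odot>\<^bsub>M\<^esub> m"
  have "bij_betw ?f (carrier (regular_module R)) (carrier M)"
    unfolding bij_betw_def
  proof
    show "inj_on ?f (carrier (regular_module R))"
    proof (rule inj_onI)
      fix r s assume rs: "r \<in> carrier (regular_module R)" "s \<in> carrier (regular_module R)" "?f r = ?f s"
      then have "r \<oplus>\<^bsub>R\<^esub> \<ominus>\<^bsub>R\<^esub> s \<in> M.annihilator m"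
        using m by (simp add: M.annihilator_def M.smult_l_distr M.smult_l_minus M.M.r_neg)
      then have "r \<oplus>\<^bsub>R\<^esub> \<ominus>\<^bsub>R\<^esub> s = \<zero>\<^bsub>R\<^esub>" unfolding ann by simp
      then show "r = s" using rs(1,2) M.R.minus_equality[of r "\<ominus>\<^bsub>R\<^esub> s"] by simp
    qed
    show "?f ` carrier (regular_module R) = carrier M"
      using gen m by (auto simp: image_iff)
  qed
  then show False
    using assms(4) scalar_hom[OF M.module_axioms m M.R.oneideal] unfolding module_isomorphic_def by blast
qed

section \<open>Comparison of the two localizations\<close>

text \<open>Finite generation of the annihilator comes from the presentation; the Pruefer hypothesis
  then yields its dual basis. All data depend on M and its presentation alone, so \<open>S\<close>
  and \<open>l\<close> are quantified last.\<close>

lemma invertible_presentation_exists: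
  fixes R :: "('a, 'm) ring_scheme" and Q :: "('a, 'd) module"
  assumes R: "pruefer_domain R" and M: "module R M"
    and pres: "fg_projective_presentation R P Q M a p"
    and m: "m \<in> carrier M" "\<And>x. x \<in> carrier M \<Longrightarrow> \<exists>r\<in>carrier R. x = r \<odot>\<^bsub>M\<^esub> m"
    and ne: "module.annihilator R M m \<noteq> {\<zero>\<^bsub>R\<^esub>}"
  shows "finitely_generated_ideal R (module.annihilator R M m)"
    and "\<exists>q0 \<sigma> \<tau> \<beta> (B :: 'a set) e c. \<forall>(S :: ('s, 'n) ring_scheme) l. ring S \<longrightarrow> l \<in> ring_hom R S \<longrightarrow>
      invertible_presentation_ring R P Q a (module.annihilator R M m) q0 \<sigma> \<tau> \<beta> S l B e c"
proof -
  let ?I = "module.annihilator R M m"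
  interpret R: domain R using R by (simp add: pruefer_domain_def)
  obtain q0 \<sigma> \<tau> \<beta> where sp: "split_presentation R P Q a ?I q0 \<sigma> \<tau> \<beta>"
    using split_presentation_exists[OF R.is_cring M pres m] by metis
  show fg: "finitely_generated_ideal R ?I"
    using split_presentation.finitely_generated_I[OF sp] pres
    by (simp add: fg_projective_presentation_def)
  obtain B :: "'a set" and e c where db: "dual_basis R (ideal_module R ?I) B e c"
    "finsum R (\<lambda>b. c b (e b)) B = \<one>\<^bsub>R\<^esub>"
    using pruefer_invertible_ideal[OF R fg ne] by blast
  have "invertible_presentation_ring R P Q a ?I q0 \<sigma> \<tau> \<beta> S l B e c"
    if "ring S" "l \<in> ring_hom R S" for S :: "('s, 'n) ring_scheme" and l
    by (intro invertible_presentation_ring.intro split_presentation_ring.intro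
        split_presentation_ring_axioms.intro invertible_presentation_ring_axioms.intro sp db that)
  then show "\<exists>q0 \<sigma> \<tau> \<beta> (B :: 'a set) e c. \<forall>(S :: ('s, 'n) ring_scheme) l. ring S \<longrightarrow> l \<in> ring_hom R S \<longrightarrow>
      invertible_presentation_ring R P Q a ?I q0 \<sigma> \<tau> \<beta> S l B e c"
    by blast
qed

text \<open>The annihilator of a generator of M belongs to the basis, hence to the topology, so
  closedness of T extends the functionals of its dual basis.\<close>

lemma localization_inverts:
  fixes R :: "('a, 'm) ring_scheme" and T :: "('q, 'k) ring_scheme"
  assumes R: "pruefer_domain R"
    and cyc: "\<forall>M\<in>\<U>. cyclic_module R M"
    and proper: "\<forall>M\<in>\<U>. \<not> module_isomorphic R (regular_module R) M"
    and basis: "basis_of_topology (ideal_basis R \<U>) G"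
    and pres: "\<forall>M\<in>\<U>. fg_projective_presentation R (P M) (Q M) M (\<alpha> M) (p M)"
    and loc: "gabriel_localization TYPE('q) R G T l"
  shows "inverts R \<U> P Q \<alpha> T l"
  unfolding inverts_def
proof
  fix M assume MU: "M \<in> \<U>"
  interpret R: domain R using R by (simp add: pruefer_domain_def)
  have M: "module R M" using cyc MU by (simp add: cyclic_module_def)
  interpret M: module R M by (rule M)
  have l: "l \<in> ring_hom R T" and ring: "ring T" and cl: "closed_module R G (restrict_scalars T l)"
    using loc by (auto simp: gabriel_localization_def)
  obtain m where mc: "m \<in> carrier M" and span: "module_span R M {m} = carrier M"
    using cyc MU unfolding cyclic_module_def by blast
  note gen = cyclic_span[OF M mc span]
  let ?I = "M.annihilator m"
  have ne: "?I \<noteq> {\<zero>\<^bsub>R\<^esub>}" by (rule annihilator_ne_zero[OF M mc gen]) (use proper MU in blast)+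
  note ipe = invertible_presentation_exists[OF R M pres[rule_format, OF MU] mc gen ne]
  have "?I \<in> ideal_basis R \<U>"
    using ipe(1) ne MU generator_quotient_isomorphic[OF R.is_cring M mc gen] unfolding ideal_basis_def by blast
  then have IG: "?I \<in> G" using basis unfolding basis_of_topology_def by blast
  obtain q0 \<sigma> \<tau> \<beta> and B :: "'a set" and e c where ip:
    "invertible_presentation_ring R (P M) (Q M) (\<alpha> M) ?I q0 \<sigma> \<tau> \<beta> T l B e c"
    using ipe(2) ring l by metis
  interpret ip: invertible_presentation_ring R "P M" "Q M" "\<alpha> M" ?I q0 \<sigma> \<tau> \<beta> T l B e c by (rule ip)
  \<comment> \<open>\<open>c b\<close> followed by \<open>l\<close> is a homomorphism from the
    annihilator to the closed module T, so an element of T represents it.\<close>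
  have "\<exists>u\<in>carrier T. \<forall>x\<in>?I. l (c b x) = l x \<otimes>\<^bsub>T\<^esub> u" if b: "b \<in> B" for b
  proof -
    have "(\<lambda>x\<in>carrier (ideal_module R ?I). l (c b x)) \<in> module_homs R (ideal_module R ?I) (restrict_scalars T l)"
      by (rule module_homsI[OF _ _ _ ip.MI.module_axioms])
         (use ip.cD[OF b] ip.l_closed ip.l_add ip.l_mult in simp_all)
    from closed_moduleD[OF cl IG this ip.ideal_I] show ?thesis by simp
  qed
  then obtain u where "\<And>b. b \<in> B \<Longrightarrow> u b \<in> carrier T"
    "\<And>b x. b \<in> B \<Longrightarrow> x \<in> ?I \<Longrightarrow> l (c b x) = l x \<otimes>\<^bsub>T\<^esub> u b" by metis
  then show "tensor_map R (\<alpha> M) (Q M) (restrict_scalars T l) \<in> iso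
      (tensor_product R (P M) (restrict_scalars T l)) (tensor_product R (Q M) (restrict_scalars T l))"
    using ip.iso_if_functionals_extend gabriel_localization_central[OF R.is_cring loc] by blast
qed

text \<open>Every ideal of the basis is the annihilator of a generator of some M in
  \<open>\<U>\<close>. Bijectivity of the tensored presentation of that M gives both conditions that
  have to be checked on a basis.\<close>

lemma inverting_ring_closed:
  fixes R :: "('a, 'm) ring_scheme" and S :: "('s, 'n) ring_scheme"
  assumes R: "pruefer_domain R"
    and cyc: "\<forall>M\<in>\<U>. cyclic_module R M"
    and top: "gabriel_topology R G" and basis: "basis_of_topology (ideal_basis R \<U>) G"
    and pres: "\<forall>M\<in>\<U>. fg_projective_presentation R (P M) (Q M) M (\<alpha> M) (p M)"
    and S: "ring S" "l \<in> ring_hom R S" and inv: "inverts R \<U> P Q \<alpha> S l"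
  shows "closed_module R G (restrict_scalars S l)"
proof -
  interpret R: domain R using R by (simp add: pruefer_domain_def)
  have "(\<forall>f\<in>module_homs R (ideal_module R I) (restrict_scalars S l). \<exists>s\<in>carrier S. \<forall>x\<in>I. f x = l x \<otimes>\<^bsub>S\<^esub> s) \<and>
      (\<forall>s\<in>carrier S. (\<forall>x\<in>I. l x \<otimes>\<^bsub>S\<^esub> s = \<zero>\<^bsub>S\<^esub>) \<longrightarrow> s = \<zero>\<^bsub>S\<^esub>)"
    if I: "I \<in> ideal_basis R \<U>" for I
  proof -
    obtain M where MU: "M \<in> \<U>" and iso: "module_isomorphic R (quotient_module R I) M"
      and ne: "I \<noteq> {\<zero>\<^bsub>R\<^esub>}" and idI: "ideal I R"
      using I unfolding ideal_basis_def finitely_generated_ideal_def by blast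
    have M: "module R M" using cyc MU by (simp add: cyclic_module_def)
    obtain m where m: "m \<in> carrier M" "\<And>x. x \<in> carrier M \<Longrightarrow> \<exists>r\<in>carrier R. x = r \<odot>\<^bsub>M\<^esub> m"
      and ann: "module.annihilator R M m = I"
      by (rule isomorphic_quotient_generator[OF R.is_cring M idI iso]) blast
    obtain q0 \<sigma> \<tau> \<beta> and B :: "'a set" and e c where ip:
      "invertible_presentation_ring R (P M) (Q M) (\<alpha> M) I q0 \<sigma> \<tau> \<beta> S l B e c"
      using invertible_presentation_exists(2)[OF R M pres[rule_format, OF MU] m] ne S unfolding ann by metis
    interpret ip: invertible_presentation_ring R "P M" "Q M" "\<alpha> M" I q0 \<sigma> \<tau> \<beta> S l B e c by (rule ip)
    have iso: "ip.\<alpha>S \<in> iso ip.PN.T ip.QN.T" using inv MU unfolding inverts_def by blast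
    show ?thesis using ip.extend_hom[OF iso] ip.ideal_faithful[OF iso] by blast
  qed
  then show ?thesis
    by (intro closed_module_if_basis[OF module_restrict_scalars[OF R.is_cring S] top basis]) auto
qed

section \<open>Forgetting additional record fields of a ring\<close>

lemma ring_truncate:
  assumes "ring S"
  shows "ring (ring.truncate S)"
proof -
  interpret S: ring S by fact
  have "abelian_group (ring.truncate S)"
    by (rule abelian_groupI)
       (auto simp: ring.defs S.a_ac intro!: bexI[of _ "\<ominus>\<^bsub>S\<^esub> _"] S.l_neg)
  moreover have "monoid (ring.truncate S)"
    by (rule monoidI) (auto simp: ring.defs S.m_assoc)
  ultimately show ?thesis
    by (rule ringI) (auto simp: ring.defs S.l_distr S.r_distr)
qed

lemma restrict_scalars_truncate: "restrict_scalars (ring.truncate S) l = restrict_scalars S l"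
  by (simp add: restrict_scalars_def ring.defs)

lemma ring_hom_truncate:
  "ring_hom R (ring.truncate S) = ring_hom R S"
  by (simp add: ring_hom_def ring.defs)

text \<open>The universal property speaks of plain ring records, whereas the target here may carry
  further fields. Truncation changes neither the homomorphisms into it nor its module
  structure.\<close>

lemma universal_localization_factor:
  fixes T :: "('t, 'k) ring_scheme"
  assumes loc: "universal_localization TYPE('t) R \<U> P Q \<alpha> S l"
    and T: "ring T" "m \<in> ring_hom R T" "inverts R \<U> P Q \<alpha> T m"
  shows "\<exists>!h. h \<in> extensional (carrier S) \<and> h \<in> ring_hom S T \<and> (\<forall>r\<in>carrier R. h (l r) = m r)"
proof -
  have "ring (ring.truncate T) \<and> m \<in> ring_hom R (ring.truncate T) \<and> inverts R \<U> P Q \<alpha> (ring.truncate T) m"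
    using ring_truncate[OF T(1)] T(2,3) by (simp add: ring_hom_truncate inverts_def restrict_scalars_truncate)
  then have "\<exists>!h. h \<in> extensional (carrier S) \<and> h \<in> ring_hom S (ring.truncate T) \<and> (\<forall>r\<in>carrier R. h (l r) = m r)"
    using loc unfolding universal_localization_def by blast
  then show ?thesis by (simp only: ring_hom_truncate)
qed

text \<open>The right factor t is kept fixed, so that both maps compared are linear for the left
  action of R; at \<open>l r\<close> both give \<open>m r\<close> times \<open>g t\<close>.
  Commutativity of S is not involved.\<close>

lemma gabriel_factor_ring_hom:
  fixes S :: "('s, 'n) ring_scheme" and Q :: "('q, 'k) ring_scheme"
  assumes R: "cring R" and S: "ring S" "m \<in> ring_hom R S"
    and loc: "gabriel_localization TYPE('s) R G Q l" and cl: "closed_module R G (restrict_scalars S m)"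
    and g: "g \<in> module_homs R (restrict_scalars Q l) (restrict_scalars S m)"
    and gl: "\<And>r. r \<in> carrier R \<Longrightarrow> g (l r) = m r"
  shows "g \<in> ring_hom Q S"
proof -
  interpret R: cring R by fact
  interpret S: ring S by fact
  have l: "l \<in> ring_hom R Q" and ring: "ring Q" using loc by (auto simp: gabriel_localization_def)
  interpret Q: ring Q by fact
  interpret N: module R "restrict_scalars Q l" by (rule module_restrict_scalars[OF R ring l])
  note gD = module_homsD[OF g, simplified]
  note lc = ring_hom_closed[OF l] and mc = ring_hom_closed[OF S(2)]
  have mult: "g (s \<otimes>\<^bsub>Q\<^esub> t) = g s \<otimes>\<^bsub>S\<^esub> g t" if s: "s \<in> carrier Q" and t: "t \<in> carrier Q" for s t
  proof -
    have 1: "(\<lambda>s\<in>carrier (restrict_scalars Q l). g (s \<otimes>\<^bsub>Q\<^esub> t)) \<in>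
        module_homs R (restrict_scalars Q l) (restrict_scalars S m)"
      by (rule module_homsI[OF _ _ _ N.module_axioms])
         (use gD(2-4) lc t in \<open>simp_all add: Q.l_distr Q.m_assoc\<close>)
    have 2: "(\<lambda>s\<in>carrier (restrict_scalars Q l). g s \<otimes>\<^bsub>S\<^esub> g t) \<in>
        module_homs R (restrict_scalars Q l) (restrict_scalars S m)"
      by (rule module_homsI[OF _ _ _ N.module_axioms])
         (use gD(2-4) mc t in \<open>simp_all add: S.l_distr S.m_assoc\<close>)
    have "(\<lambda>s\<in>carrier (restrict_scalars Q l). g (s \<otimes>\<^bsub>Q\<^esub> t)) = (\<lambda>s\<in>carrier (restrict_scalars Q l). g s \<otimes>\<^bsub>S\<^esub> g t)"
      by (rule gabriel_localization_unique[OF R loc cl 1 2]) (use lc gl gD(4) t in simp)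
    from fun_cong[OF this, of s] show ?thesis using s by simp
  qed
  have "g \<one>\<^bsub>Q\<^esub> = \<one>\<^bsub>S\<^esub>" using gl[OF R.one_closed] ring_hom_one[OF l] ring_hom_one[OF S(2)] by simp
  then show ?thesis using gD mult by (auto intro: ring_hom_memI)
qed

text \<open>Each universal property is used at both types: across, to produce a map to the other
  ring, and at the type of its own ring, to identify the composite on it with the identity.\<close>

theorem proposition4p8:
  fixes R :: "('a, 'm) ring_scheme"
    and \<U> :: "('a, 'b) module set"
    and \<L> :: "'a set set"
    and P :: "('a, 'b) module \<Rightarrow> ('a, 'c) module"
    and Q :: "('a, 'b) module \<Rightarrow> ('a, 'd) module"
    and \<alpha> :: "('a, 'b) module \<Rightarrow> 'c \<Rightarrow> 'd"
    and \<pi> :: "('a, 'b) module \<Rightarrow> 'd \<Rightarrow> 'b"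
    and R\<^sub>U :: "('s, 'n) ring_scheme" and lam\<^sub>U :: "'a \<Rightarrow> 's"
    and Q\<^sub>L :: "('q, 'k) ring_scheme" and lam\<^sub>L :: "'a \<Rightarrow> 'q"
  assumes "pruefer_domain R"
    and "\<forall>M\<in>\<U>. finitely_presented_module R M \<and> cyclic_module R M"
    and "\<forall>M\<in>\<U>. \<not> module_isomorphic R (regular_module R) M"
    and "gabriel_topology R \<L>"
    and "basis_of_topology (ideal_basis R \<U>) \<L>"
    and "\<forall>M\<in>\<U>. fg_projective_presentation R (P M) (Q M) M (\<alpha> M) (\<pi> M)"
    and "universal_localization TYPE('s) R \<U> P Q \<alpha> R\<^sub>U lam\<^sub>U"
    and "universal_localization TYPE('q) R \<U> P Q \<alpha> R\<^sub>U lam\<^sub>U"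
    and "gabriel_localization TYPE('q) R \<L> Q\<^sub>L lam\<^sub>L"
    and "gabriel_localization TYPE('s) R \<L> Q\<^sub>L lam\<^sub>L"
  shows "\<exists>\<phi>\<in>ring_iso R\<^sub>U Q\<^sub>L. \<forall>r\<in>carrier R. lam\<^sub>L r = \<phi> (lam\<^sub>U r)"
proof -
  interpret R: domain R using assms(1) by (simp add: pruefer_domain_def)
  have cyc: "\<forall>M\<in>\<U>. cyclic_module R M" using assms(2) by blast
  have U: "ring R\<^sub>U" "lam\<^sub>U \<in> ring_hom R R\<^sub>U" "inverts R \<U> P Q \<alpha> R\<^sub>U lam\<^sub>U"
    using assms(7) unfolding universal_localization_def by blast+
  have L: "ring Q\<^sub>L" "lam\<^sub>L \<in> ring_hom R Q\<^sub>L" "closed_module R \<L> (restrict_scalars Q\<^sub>L lam\<^sub>L)"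
    using assms(9) unfolding gabriel_localization_def by blast+
  interpret U: ring R\<^sub>U by (rule U(1))
  let ?NU = "restrict_scalars R\<^sub>U lam\<^sub>U" and ?NL = "restrict_scalars Q\<^sub>L lam\<^sub>L"
  interpret NL: module R ?NL by (rule module_restrict_scalars[OF R.is_cring L(1,2)])
  have Ucl: "closed_module R \<L> ?NU"
    by (rule inverting_ring_closed[OF assms(1) cyc assms(4-6) U])
  have Linv: "inverts R \<U> P Q \<alpha> Q\<^sub>L lam\<^sub>L"
    by (rule localization_inverts[OF assms(1) cyc assms(3,5,6,9)])
  obtain h where h: "h \<in> extensional (carrier R\<^sub>U)" "h \<in> ring_hom R\<^sub>U Q\<^sub>L"
    "\<And>r. r \<in> carrier R \<Longrightarrow> h (lam\<^sub>U r) = lam\<^sub>L r"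
    using universal_localization_factor[OF assms(8) L(1,2) Linv] by blast
  have "(\<lambda>r\<in>carrier (regular_module R). lam\<^sub>U r) \<in> module_homs R (regular_module R) ?NU"
    by (rule module_homsI[OF _ _ _ R.module_regular])
       (use ring_hom_closed[OF U(2)] ring_hom_add[OF U(2)] ring_hom_mult[OF U(2)] in simp_all)
  then have "\<exists>!g. g \<in> module_homs R ?NL ?NU \<and>
      (\<forall>r\<in>carrier R. g (lam\<^sub>L r) = (\<lambda>r\<in>carrier (regular_module R). lam\<^sub>U r) r)"
    using assms(10) Ucl unfolding gabriel_localization_def by blast
  then obtain g where g: "g \<in> module_homs R ?NL ?NU"
    and "\<forall>r\<in>carrier R. g (lam\<^sub>L r) = (\<lambda>r\<in>carrier (regular_module R). lam\<^sub>U r) r"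
    by blast
  then have gl: "g (lam\<^sub>L r) = lam\<^sub>U r" if "r \<in> carrier R" for r using that by simp
  have gr: "g \<in> ring_hom Q\<^sub>L R\<^sub>U"
    by (rule gabriel_factor_ring_hom[OF R.is_cring U(1,2) assms(10) Ucl g gl])
  note gD = module_homsD[OF g, simplified]
  note hc = ring_hom_closed[OF h(2)] and gc = ring_hom_closed[OF gr]
  have hg: "h (g s) = s" if s: "s \<in> carrier Q\<^sub>L" for s
  proof -
    \<comment> \<open>The composite is R-linear because \<open>g\<close> is linear and
      \<open>h\<close> carries \<open>lam\<^sub>U r\<close> to \<open>lam\<^sub>L r\<close>.\<close>
    have 1: "(\<lambda>s\<in>carrier ?NL. h (g s)) \<in> module_homs R ?NL ?NL"
      by (rule module_homsI[OF _ _ _ NL.module_axioms])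
         (use gD(2-4) hc ring_hom_add[OF h(2)] ring_hom_mult[OF h(2)] ring_hom_closed[OF U(2)] h(3) in simp_all)
    have 2: "(\<lambda>s\<in>carrier ?NL. s) \<in> module_homs R ?NL ?NL"
      by (rule module_homsI[OF _ _ _ NL.module_axioms]) (use ring_hom_closed[OF L(2)] in simp_all)
    have "(\<lambda>s\<in>carrier ?NL. h (g s)) = (\<lambda>s\<in>carrier ?NL. s)"
      by (rule gabriel_localization_unique[OF R.is_cring assms(9) L(3) 1 2])
         (use gl h(3) ring_hom_closed[OF L(2)] in simp)
    from fun_cong[OF this, of s] show ?thesis using s by simp
  qed
  have gh: "g (h s) = s" if s: "s \<in> carrier R\<^sub>U" for s
  proof -
    have 1: "(\<lambda>s\<in>carrier R\<^sub>U. g (h s)) \<in> ring_hom R\<^sub>U R\<^sub>U"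
      by (rule ring_hom_memI)
         (use hc gc ring_hom_add[OF h(2)] ring_hom_mult[OF h(2)] ring_hom_one[OF h(2)]
            ring_hom_add[OF gr] ring_hom_mult[OF gr] ring_hom_one[OF gr] in simp_all)
    have 2: "(\<lambda>s\<in>carrier R\<^sub>U. s) \<in> ring_hom R\<^sub>U R\<^sub>U"
      by (rule ring_hom_memI) simp_all
    have 3: "\<forall>r\<in>carrier R. (\<lambda>s\<in>carrier R\<^sub>U. g (h s)) (lam\<^sub>U r) = lam\<^sub>U r"
      "\<forall>r\<in>carrier R. (\<lambda>s\<in>carrier R\<^sub>U. s) (lam\<^sub>U r) = lam\<^sub>U r"
      using gl h(3) ring_hom_closed[OF U(2)] by simp_all
    \<comment> \<open>Both are factorizations of \<open>lam\<^sub>U\<close> through itself; they are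
      restricted to the carrier because uniqueness concerns extensional maps.\<close>
    have "(\<lambda>s\<in>carrier R\<^sub>U. g (h s)) = (\<lambda>s\<in>carrier R\<^sub>U. s)"
      by (rule ex1E[OF universal_localization_factor[OF assms(7) U]]) (metis 1 2 3 restrict_extensional)
    from fun_cong[OF this, of s] show ?thesis using s by simp
  qed
  have "bij_betw h (carrier R\<^sub>U) (carrier Q\<^sub>L)"
    by (rule bij_betw_byWitness[of _ g]) (use hg gh hc gc in auto)
  then have "h \<in> ring_iso R\<^sub>U Q\<^sub>L" using h(2) by (simp add: ring_iso_def)
  then show ?thesis using h(3) by (intro bexI[of _ h]) simp_all
qed

end
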